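(* Let $E=\{0,1,\dots,n\}$, let $M$ be a loopless matroid on $E$, and let $v=(v_1,\dots,v_k)$ be a vector of positive integers. Then in $A^*(M)$, \[\gamma_{v_1}\cdots\gamma_{v_k}=\sum_{(T,\sigma,F)}\mathrm{wt}_v(T,\sigma,F)\,x_{\mathcal{F}(T,F)},\] where the sum is over all $v$-compatible flat-filled increasing binary trees $(T,\sigma,F)$ on $k$ vertices, and $\mathrm{wt}_v$ may be taken to be either $\mathrm{wt}^{\mathrm{OI}}_v$ or $\mathrm{wt}^{\mathrm{mult}}_v$.
   Context: The Chow ring $A^*(M)$ (real coefficients) is $\mathbb{R}[x_G : G \text{ a nonempty proper flat of } M]$ modulo the ideal generated by all $x_{G_1}x_{G_2}$ with $G_1,G_2$ incomparable and all $\sum_{G\ni i}x_G-\sum_{G\ni j}x_G$ for $i,j\in E$. For $S\subseteq E$, $x_S$ means the generator if $S$ is a nonempty proper flat and $0$ otherwise. For a finite set $U$, $S,T\subseteq U$ and an integer $m$: $\mathrm{OI}_U(S,T)=|S\cap T|-\max(0,|S|+|T|-|U|)$ and $\mathrm{mult}_U(|S|,m)=\min(|S|,m)-\frac{m}{|U|}|S|$. Hypersimplex classes: $\gamma_m=\sum_S\mathrm{mult}_E(|S|,m)x_S$ for $1\le m\le n$ (sum over nonempty proper $S\subsetneq E$), $\gamma_m=0$ otherwise. A binary tree is a finite rooted tree in which each vertex has at most one left child and at most one right child; binary trees are considered up to isomorphism. Its binary search order is the total order on vertices generated by $b<a$ whenever $b$ lies in the left subtree of $a$ and $a<b$ whenever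 $b$ lies in the right subtree of $a$. An increasing labeling of a binary tree $T$ with $k$ vertices is a bijection $\sigma:V(T)\to\{1,\dots,k\}$ with $\sigma(b)\ge\sigma(a)$ whenever $b$ is a descendant of $a$; $(T,\sigma)$ is an increasing binary tree. $T_{\le i}$ is the subtree induced on $\sigma^{-1}(\{1,\dots,i\})$ (a binary tree whose binary search order is the restriction). A flat-filling is a map $F$ from $V(T)$ to nonempty proper flats of $M$ such that $a<b$ in binary search order implies $F(a)\subsetneq F(b)$; its image is a chain of flats $\mathcal{F}(T,F)$, and $x_{\mathcal{F}(T,F)}$ is the product of $x_G$ over $G$ in this chain. For $b\in V(T)$, $\ell(b)$ and $r(b)$ are the immediate predecessor and successor of $b$ in the binary search order of $T_{\le\sigma(b)}$, with the conventions $F(\ell(b))=\varnothing$ if $b$ is minimal and $F(r(b))=E$ if $b$ is maximal in $T_{\le\sigma(b)}$. $(T,\sigma,F)$ is $v$-compatible if $|F(\ell(b))|<v_{\sigma(b)}<|F(r(b))|$ for all $b\in V(T)$. The weights are $\mathrm{wt}^{\mathrm{OI}}_v(T,\sigma,F)=\prod_{b}\mathrm{OI}_{F(r(b))\setminus F(\ell(b))}\big(F(b)\setminus F(\ell(b)),U_b\big)$, where $U_b$ is the set of the largest $|F(r(b))|-v_{\sigma(b)}$ elements of $F(r(b))\setminus F(\ell(b))$, and $\mathrm{wt}^{\mathrm{mult}}_v(T,\sigma,F)=\prod_b\mathrm{mult}_{F(r(b))\setminus F(\ell(b))}\big(|F(b)\setminus F(\ell(b))|,\,v_{\sigma(b)}-|F(\ell(b))|\big)$;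 the empty tree has weight $1$. *)

theory Defs
  imports
    Complex_Main
    "HOL-Library.FuncSet"
    "HOL-Library.Sublist"
    "HOL-Library.Poly_Mapping"
    "HOL-Algebra.QuotRing"
begin

section \<open>Matroids\<close>

record 'a set_system =
  ground :: "'a set"
  indep :: "'a set set"

definition matroid :: "'a set_system \<Rightarrow> bool" where
  "matroid M \<longleftrightarrow>
     finite (ground M) \<and>
     indep M \<subseteq> Pow (ground M) \<and>
     {} \<in> indep M \<and>
     (\<forall>I\<in>indep M. \<forall>J. J \<subseteq> I \<longrightarrow> J \<in> indep M) \<and>
     (\<forall>I\<in>indep M. \<forall>J\<in>indep M. card I < card J \<longrightarrow> (\<exists>e\<in>J - I. insert e I \<in> indep M))"

definition loopless :: "'a set_system \<Rightarrow> bool" where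
  "loopless M \<longleftrightarrow> (\<forall>e\<in>ground M. {e} \<in> indep M)"

definition rk :: "'a set_system \<Rightarrow> 'a set \<Rightarrow> nat" where
  "rk M S = Max (card ` {I \<in> indep M. I \<subseteq> S})"

definition flat :: "'a set_system \<Rightarrow> 'a set \<Rightarrow> bool" where
  "flat M G \<longleftrightarrow> G \<subseteq> ground M \<and> (\<forall>e\<in>ground M - G. rk M G < rk M (insert e G))"

definition proper_flats :: "'a set_system \<Rightarrow> 'a set set" where
  "proper_flats M = {G. flat M G \<and> G \<noteq> {} \<and> G \<noteq> ground M}"


section \<open>The Chow ring\<close>

text \<open>
  Monomials are finitely supported exponent vectors, so finitely supported real functions on
  monomials, with their convolution product, are the real polynomials with variables indexed by
  the type \<open>'v\<close>.
\<close>

type_synonym 'v mpoly = "('v \<Rightarrow>\<^sub>0 nat) \<Rightarrow>\<^sub>0 real"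

definition Const :: "real \<Rightarrow> 'v mpoly" where
  "Const c = Poly_Mapping.single 0 c"

definition Var :: "'v \<Rightarrow> 'v mpoly" where
  "Var i = Poly_Mapping.single (Poly_Mapping.single i 1) 1"

definition polynomial_ring :: "'v set \<Rightarrow> 'v mpoly ring" where
  "polynomial_ring I =
     \<lparr>carrier = {p. \<forall>m\<in>Poly_Mapping.keys p. Poly_Mapping.keys m \<subseteq> I},
      mult = (*), one = 1, zero = 0, add = (+)\<rparr>"

definition chow_relations :: "'a set_system \<Rightarrow> 'a set mpoly set" where
  "chow_relations M =
     {Var G\<^sub>1 * Var G\<^sub>2 | G\<^sub>1 G\<^sub>2.
        G\<^sub>1 \<in> proper_flats M \<and> G\<^sub>2 \<in> proper_flats M \<and> \<not> G\<^sub>1 \<subseteq> G\<^sub>2 \<and> \<not> G\<^sub>2 \<subseteq> G\<^sub>1} \<union>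
     {(\<Sum>G\<in>{G \<in> proper_flats M. i \<in> G}. Var G) - (\<Sum>G\<in>{G \<in> proper_flats M. j \<in> G}. Var G) | i j.
        i \<in> ground M \<and> j \<in> ground M}"

definition chow_ideal :: "'a set_system \<Rightarrow> 'a set mpoly set" where
  "chow_ideal M = Idl\<^bsub>polynomial_ring (proper_flats M)\<^esub> (chow_relations M)"

definition chow_ring :: "'a set_system \<Rightarrow> 'a set mpoly set ring" where
  "chow_ring M = polynomial_ring (proper_flats M) Quot chow_ideal M"

definition chow_class :: "'a set_system \<Rightarrow> 'a set mpoly \<Rightarrow> 'a set mpoly set" where
  "chow_class M p = chow_ideal M +>\<^bsub>polynomial_ring (proper_flats M)\<^esub> p"

definition chow_scale :: "'a set_system \<Rightarrow> real \<Rightarrow> 'a set mpoly set \<Rightarrow> 'a set mpoly set" where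
  "chow_scale M c y = chow_class M (Const c) \<otimes>\<^bsub>chow_ring M\<^esub> y"

definition chow_x :: "'a set_system \<Rightarrow> 'a set \<Rightarrow> 'a set mpoly set" where
  "chow_x M S = (if S \<in> proper_flats M then chow_class M (Var S) else \<zero>\<^bsub>chow_ring M\<^esub>)"


section \<open>Hypersimplex classes\<close>

definition OI :: "'a set \<Rightarrow> 'a set \<Rightarrow> 'a set \<Rightarrow> int" where
  "OI U S T = int (card (S \<inter> T)) - max 0 (int (card S) + int (card T) - int (card U))"

definition mlt :: "'a set \<Rightarrow> nat \<Rightarrow> int \<Rightarrow> real" where
  "mlt U s m = real_of_int (min (int s) m) - real_of_int m / real (card U) * real s"

text \<open>The bound below is \<open>1 \<le> m \<le> n\<close>, as the ground set has \<open>n + 1\<close> elements.\<close>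

definition hypersimplex_class :: "'a set_system \<Rightarrow> nat \<Rightarrow> 'a set mpoly set" where
  "hypersimplex_class M m =
     (if 1 \<le> m \<and> m < card (ground M)
      then \<Oplus>\<^bsub>chow_ring M\<^esub>S\<in>{S. S \<noteq> {} \<and> S \<subset> ground M}.
             chow_scale M (mlt (ground M) (card S) (int m)) (chow_x M S)
      else \<zero>\<^bsub>chow_ring M\<^esub>)"


section \<open>Increasing binary trees\<close>

text \<open>
  A vertex is identified with the word of left/right steps leading to it from the root. A binary
  tree becomes its set of vertices, a finite prefix-closed set of words; every isomorphism class of
  binary trees (including the empty one) contains exactly one such set. The descendants of a vertex
  are its extensions.
\<close>

datatype direction = Left | Right

type_synonym vertex = "direction list"

definition binary_tree :: "vertex set \<Rightarrow> bool" where
  "binary_tree T \<longleftrightarrow> finite T \<and> (\<forall>b\<in>T. \<forall>a. prefix a b \<longrightarrow> a \<in> T)"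

definition search_order :: "vertex set \<Rightarrow> (vertex \<times> vertex) set" where
  "search_order T =
     ({(b, a). a \<in> T \<and> b \<in> T \<and> prefix (a @ [Left]) b} \<union>
      {(a, b). a \<in> T \<and> b \<in> T \<and> prefix (a @ [Right]) b})\<^sup>+"

definition increasing_labeling :: "nat \<Rightarrow> vertex set \<Rightarrow> (vertex \<Rightarrow> nat) \<Rightarrow> bool" where
  "increasing_labeling k T \<sigma> \<longleftrightarrow>
     bij_betw \<sigma> T {1..k} \<and> (\<forall>a\<in>T. \<forall>b\<in>T. prefix a b \<longrightarrow> \<sigma> a \<le> \<sigma> b)"

definition subtree_upto :: "vertex set \<Rightarrow> (vertex \<Rightarrow> nat) \<Rightarrow> nat \<Rightarrow> vertex set" where
  "subtree_upto T \<sigma> i = {a \<in> T. \<sigma> a \<le> i}"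

definition flat_filling :: "'a set_system \<Rightarrow> vertex set \<Rightarrow> (vertex \<Rightarrow> 'a set) \<Rightarrow> bool" where
  "flat_filling M T F \<longleftrightarrow>
     F ` T \<subseteq> proper_flats M \<and> (\<forall>a b. (a, b) \<in> search_order T \<longrightarrow> F a \<subset> F b)"

definition covers :: "('v \<times> 'v) set \<Rightarrow> 'v \<Rightarrow> 'v \<Rightarrow> bool" where
  "covers r a b \<longleftrightarrow> (a, b) \<in> r \<and> \<not> (\<exists>c. (a, c) \<in> r \<and> (c, b) \<in> r)"

text \<open>
  The flats attached to the immediate predecessor and the immediate successor of \<open>b\<close>, with the
  conventions for minimal and maximal \<open>b\<close>.
\<close>

definition flat_left :: "vertex set \<Rightarrow> (vertex \<Rightarrow> nat) \<Rightarrow> (vertex \<Rightarrow> 'a set) \<Rightarrow> vertex \<Rightarrow> 'a set" where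
  "flat_left T \<sigma> F b =
     (let r = search_order (subtree_upto T \<sigma> (\<sigma> b)) in
      if \<exists>a. (a, b) \<in> r then F (THE a. covers r a b) else {})"

definition flat_right ::
  "'a set_system \<Rightarrow> vertex set \<Rightarrow> (vertex \<Rightarrow> nat) \<Rightarrow> (vertex \<Rightarrow> 'a set) \<Rightarrow> vertex \<Rightarrow> 'a set" where
  "flat_right M T \<sigma> F b =
     (let r = search_order (subtree_upto T \<sigma> (\<sigma> b)) in
      if \<exists>a. (b, a) \<in> r then F (THE a. covers r b a) else ground M)"

definition compatible ::
  "'a set_system \<Rightarrow> (nat \<Rightarrow> nat) \<Rightarrow> vertex set \<Rightarrow> (vertex \<Rightarrow> nat) \<Rightarrow> (vertex \<Rightarrow> 'a set) \<Rightarrow> bool" where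
  "compatible M v T \<sigma> F \<longleftrightarrow>
     (\<forall>b\<in>T. card (flat_left T \<sigma> F b) < v (\<sigma> b) \<and> v (\<sigma> b) < card (flat_right M T \<sigma> F b))"

text \<open>
  Labelings and fillings are functions on the vertex set only; extensionality makes each of them
  occur once in the index set.
\<close>

definition compatible_trees ::
  "'a set_system \<Rightarrow> nat \<Rightarrow> (nat \<Rightarrow> nat) \<Rightarrow> (vertex set \<times> (vertex \<Rightarrow> nat) \<times> (vertex \<Rightarrow> 'a set)) set" where
  "compatible_trees M k v =
     {(T, \<sigma>, F). binary_tree T \<and>
        \<sigma> \<in> extensional T \<and> increasing_labeling k T \<sigma> \<and>
        F \<in> extensional T \<and> flat_filling M T F \<and> compatible M v T \<sigma> F}"

definition largest :: "nat \<Rightarrow> 'a::linorder set \<Rightarrow> 'a set" where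
  "largest m A = {x \<in> A. card {y \<in> A. x < y} < m}"

definition wt_OI ::
  "'a::linorder set_system \<Rightarrow> (nat \<Rightarrow> nat) \<Rightarrow> vertex set \<Rightarrow> (vertex \<Rightarrow> nat) \<Rightarrow> (vertex \<Rightarrow> 'a set) \<Rightarrow> real" where
  "wt_OI M v T \<sigma> F =
     (\<Prod>b\<in>T.
        let A = flat_left T \<sigma> F b; B = flat_right M T \<sigma> F b
        in real_of_int (OI (B - A) (F b - A) (largest (card B - v (\<sigma> b)) (B - A))))"

definition wt_mult ::
  "'a set_system \<Rightarrow> (nat \<Rightarrow> nat) \<Rightarrow> vertex set \<Rightarrow> (vertex \<Rightarrow> nat) \<Rightarrow> (vertex \<Rightarrow> 'a set) \<Rightarrow> real" where
  "wt_mult M v T \<sigma> F =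
     (\<Prod>b\<in>T.
        let A = flat_left T \<sigma> F b; B = flat_right M T \<sigma> F b
        in mlt (B - A) (card (F b - A)) (int (v (\<sigma> b)) - int (card A)))"

definition chow_x_chain :: "'a set_system \<Rightarrow> vertex set \<Rightarrow> (vertex \<Rightarrow> 'a set) \<Rightarrow> 'a set mpoly set" where
  "chow_x_chain M T F = (\<Otimes>\<^bsub>chow_ring M\<^esub>G\<in>F ` T. chow_x M G)"

end

theory Submission
  imports Defs
begin

text \<open>
  Since all the classes \<open>\<Sum>\<^sub>G\<^sub>\<ni>\<^sub>e x\<^sub>G\<close> agree, \<open>\<gamma>\<^sub>m = \<Sum>\<^sub>S (min |S| m - w(S)) x\<^sub>S\<close> for every weight vector
  \<open>w\<close> on the ground set of total mass \<open>m\<close>. Multiplying by the monomial of a chain of flats kills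
  every \<open>S\<close> that is incomparable to the chain. Among \<open>{}\<close>, \<open>E\<close> and the members of the chain, let \<open>A\<close> be
  the largest with \<open>|A| \<le> m\<close> and \<open>B\<close> the smallest with \<open>m \<le> |B|\<close>. Choosing \<open>w = 1\<close> on \<open>A\<close> and \<open>w = 0\<close> off \<open>B\<close> leaves
  only the \<open>S\<close> strictly between \<open>A\<close> and \<open>B\<close>, and nothing if \<open>A = B\<close>. Spreading the remaining mass
  uniformly over \<open>B - A\<close> gives the weight \<open>mult\<close>, and placing it on the smallest elements of \<open>B - A\<close>
  gives \<open>OI\<close>. Iterating, \<open>\<gamma>\<^sub>v\<^sub>1 \<cdots> \<gamma>\<^sub>v\<^sub>k\<close> becomes a sum over sequences \<open>G\<^sub>1, \<dots>, G\<^sub>k\<close> of pairwise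
  strictly comparable flats. These sequences correspond to the flat-filled increasing binary trees
  by \<open>G\<^sub>i = F (\<sigma>\<^sup>-\<^sup>1 i)\<close>, as the tree is recovered by successive insertion into a binary search tree.
\<close>

section \<open>Binary search order\<close>

text \<open>Placing the vertices at dyadic positions turns the search order into the order of the reals,
  so that it is linear for free.\<close>

fun inorder_pos :: "vertex \<Rightarrow> real" where
  "inorder_pos [] = 0"
| "inorder_pos (Left # w) = (inorder_pos w - 1) / 2"
| "inorder_pos (Right # w) = (inorder_pos w + 1) / 2"

lemma inorder_pos_bounds: "-1 < inorder_pos w" "inorder_pos w < 1"
  by (induction w rule: inorder_pos.induct) auto

lemma inorder_pos_neg_iff: "inorder_pos a < 0 \<longleftrightarrow> prefix [Left] a"
  and inorder_pos_pos_iff: "0 < inorder_pos a \<longleftrightarrow> prefix [Right] a"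
  using inorder_pos_bounds[of "tl a"] by (cases a rule: inorder_pos.cases; simp)+

lemma inorder_pos_eq_iff [simp]: "inorder_pos a = inorder_pos b \<longleftrightarrow> a = b"
proof (induction a arbitrary: b)
  case Nil
  then show ?case
    using inorder_pos_bounds[of "tl b"] by (cases b rule: inorder_pos.cases) auto
next
  case (Cons x a)
  then show ?case
    using inorder_pos_bounds[of a] inorder_pos_bounds[of "tl b"]
    by (cases x; cases b rule: inorder_pos.cases) auto
qed

lemma inorder_pos_less_iff:
  "inorder_pos a < inorder_pos b \<longleftrightarrow>
     prefix (b @ [Left]) a \<or> prefix (a @ [Right]) b \<or>
     (\<exists>p. prefix (p @ [Left]) a \<and> prefix (p @ [Right]) b)"
proof (induction a arbitrary: b)
  case Nil
  then show ?case
    by (simp add: inorder_pos_pos_iff)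
next
  case (Cons x a)
  show ?case
  proof (cases b)
    case Nil
    then show ?thesis
      using inorder_pos_neg_iff[of "x # a"] by auto
  next
    case (Cons y b')
    have "(\<exists>p. prefix (p @ [Left]) (x # a) \<and> prefix (p @ [Right]) (y # b')) \<longleftrightarrow>
        x = Left \<and> y = Right \<or> x = y \<and> (\<exists>p. prefix (p @ [Left]) a \<and> prefix (p @ [Right]) b')"
    proof
      assume "\<exists>p. prefix (p @ [Left]) (x # a) \<and> prefix (p @ [Right]) (y # b')"
      then obtain p where "prefix (p @ [Left]) (x # a)" "prefix (p @ [Right]) (y # b')" by blast
      then show "x = Left \<and> y = Right \<or> x = y \<and> (\<exists>p. prefix (p @ [Left]) a \<and> prefix (p @ [Right]) b')"
        by (cases p) auto
    qed (auto intro: exI[of _ "[]"] exI[of _ "x # p" for p])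
    then show ?thesis
      using Cons Cons.IH[of b'] inorder_pos_bounds[of a] inorder_pos_bounds[of b']
      by (cases x; cases y) auto
  qed
qed

lemma search_order_eq:
  assumes "binary_tree T"
  shows "search_order T = {(a, b). a \<in> T \<and> b \<in> T \<and> inorder_pos a < inorder_pos b}"
    (is "_ = ?less")
proof -
  let ?step = "{(b, a). a \<in> T \<and> b \<in> T \<and> prefix (a @ [Left]) b} \<union>
      {(a, b). a \<in> T \<and> b \<in> T \<and> prefix (a @ [Right]) b}"
  have "?step \<subseteq> ?less"
    by (auto simp: inorder_pos_less_iff)
  moreover have "trans ?less"
    by (auto intro: transI)
  ultimately have "?step\<^sup>+ \<subseteq> ?less"
    using trancl_mono_subset[of ?step ?less] by (simp only: trancl_id)
  moreover have "(a, b) \<in> ?step\<^sup>+" if "(a, b) \<in> ?less" for a b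
  proof -
    have ab: "a \<in> T" "b \<in> T" "inorder_pos a < inorder_pos b"
      using that by auto
    then consider (step) "(a, b) \<in> ?step"
      | (meet) p where "prefix (p @ [Left]) a" "prefix (p @ [Right]) b"
      by (auto simp: inorder_pos_less_iff)
    then show ?thesis
    proof cases
      case (meet p)
      then have "p \<in> T"
        using assms ab(1) prefix_snocD[OF meet(1)] by (auto simp: binary_tree_def strict_prefix_def)
      then have "(a, p) \<in> ?step" "(p, b) \<in> ?step"
        using meet ab by auto
      then show ?thesis
        by (rule trancl.trancl_into_trancl[OF trancl.r_into_trancl])
    qed (rule r_into_trancl)
  qed
  ultimately show ?thesis
    unfolding search_order_def by auto
qed

lemma strict_linear_order_on_search_order:
  "binary_tree T \<Longrightarrow> strict_linear_order_on T (search_order T)"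
  by (auto simp: search_order_eq strict_linear_order_on_def irrefl_def total_on_def neq_iff
      simp flip: inorder_pos_eq_iff intro: transI)

lemma search_order_subset: "binary_tree T \<Longrightarrow> search_order T \<subseteq> T \<times> T"
  by (auto simp: search_order_eq)

lemma finite_binary_tree: "binary_tree T \<Longrightarrow> finite T"
  by (simp add: binary_tree_def)

lemma immediate_predecessor:
  assumes "strict_linear_order_on A r" "r \<subseteq> A \<times> A" "finite A" "(c\<^sub>0, b) \<in> r"
  obtains a where "(a, b) \<in> r" "(THE a. covers r a b) = a" "\<And>c. (c, b) \<in> r \<Longrightarrow> c = a \<or> (c, a) \<in> r"
proof -
  have r: "trans r" "irrefl r" "total_on A r"
    using assms(1) by (auto simp: strict_linear_order_on_def)
  have "finite r"
    using assms(2,3) by (meson finite_SigmaI finite_subset)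
  then have "wf (r\<inverse>)"
    using r by (intro finite_acyclic_wf_converse) (simp_all add: acyclic_irrefl)
  then obtain a where a: "(a, b) \<in> r" "\<And>c. (a, c) \<in> r \<Longrightarrow> (c, b) \<notin> r"
    using wfE_min[of "r\<inverse>" c\<^sub>0 "{a. (a, b) \<in> r}"] assms(4) by auto
  have greatest: "c = a \<or> (c, a) \<in> r" if "(c, b) \<in> r" for c
    using a that assms(2) r(3) unfolding total_on_def by blast
  have "covers r a b"
    using a by (auto simp: covers_def)
  moreover have "c = a" if "covers r c b" for c
    using that greatest a(1) unfolding covers_def by blast
  ultimately have "(THE a. covers r a b) = a"
    by (rule the_equality)
  with a(1) show thesis
    using greatest by (rule that)
qed

lemma immediate_successor:
  assumes "strict_linear_order_on A r" "r \<subseteq> A \<times> A" "finite A" "(b, c\<^sub>0) \<in> r"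
  obtains a where "(b, a) \<in> r" "(THE a. covers r b a) = a" "\<And>c. (b, c) \<in> r \<Longrightarrow> c = a \<or> (a, c) \<in> r"
proof -
  have "strict_linear_order_on A (r\<inverse>)"
    using assms(1) by (simp add: strict_linear_order_on_def)
  moreover have "covers (r\<inverse>) = (\<lambda>a b. covers r b a)"
    by (auto simp: covers_def fun_eq_iff)
  ultimately show thesis
    using immediate_predecessor[of A "r\<inverse>" c\<^sub>0 b] assms(2-4) that by auto
qed

section \<open>Growing trees leaf by leaf\<close>

text \<open>The new leaf is the point where the descent from the root, going right exactly at the
  vertices of the lower set \<open>L\<close>, leaves the tree.\<close>

definition search_path :: "vertex set \<Rightarrow> vertex \<Rightarrow> bool" where
  "search_path L b \<longleftrightarrow> (\<forall>a x. prefix (a @ [x]) b \<longrightarrow> (x = Right \<longleftrightarrow> a \<in> L))"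

lemma search_path_leaf_exists:
  assumes "binary_tree T"
  obtains b where "b \<notin> T" "\<And>a. strict_prefix a b \<Longrightarrow> a \<in> T" "search_path L b"
proof (cases "T = {}")
  case True
  then show thesis
    using that[of "[]"] by (simp add: search_path_def)
next
  case False
  define W where "W = {a \<in> T. search_path L a}"
  have "[] \<in> W"
    using assms False by (auto simp: W_def search_path_def binary_tree_def)
  moreover have "finite W"
    using assms by (simp add: W_def binary_tree_def)
  ultimately obtain a where a: "a \<in> W" "\<And>c. c \<in> W \<Longrightarrow> length c \<le> length a"
    using ex_has_greatest_nat[of "\<lambda>a. a \<in> W" "[]" length "Suc (Max (length ` W))"]
    by (auto simp: less_Suc_eq_le)
  define b where "b = a @ [if a \<in> L then Right else Left]"
  have path: "search_path L b"
    using a(1) by (auto simp: W_def search_path_def b_def)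
  moreover have "b \<notin> T"
    using a(2)[of b] path by (auto simp: W_def b_def)
  moreover have "c \<in> T" if "strict_prefix c b" for c
    using that a(1) assms by (auto simp: W_def b_def binary_tree_def strict_prefix_def)
  ultimately show thesis
    by (rule that[rotated 2])
qed

lemma not_below_leaf:
  assumes "binary_tree T" "b \<notin> T" "a \<in> T"
  shows "\<not> prefix (b @ [x]) a"
  using assms prefix_snocD[of b x a] by (auto simp: binary_tree_def strict_prefix_def)

lemma less_search_path_leafD:
  assumes T: "binary_tree T" and b: "b \<notin> T" "search_path L b" and a: "a \<in> T"
    and lower: "\<And>c. c \<in> L \<Longrightarrow> inorder_pos a < inorder_pos c \<Longrightarrow> a \<in> L"
    and less: "inorder_pos a < inorder_pos b"
  shows "a \<in> L"
proof -
  consider (below) "prefix (a @ [Right]) b" | (meet) p where "prefix (p @ [Left]) a" "prefix (p @ [Right]) b"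
    using less not_below_leaf[OF T b(1) a] by (auto simp: inorder_pos_less_iff)
  then show ?thesis
  proof cases
    case below
    then show ?thesis
      using b(2) by (auto simp: search_path_def)
  next
    case (meet p)
    then have "p \<in> L" "inorder_pos a < inorder_pos p"
      using b(2) by (auto simp: search_path_def inorder_pos_less_iff)
    then show ?thesis
      by (rule lower)
  qed
qed

lemma greater_search_path_leafD:
  assumes T: "binary_tree T" and b: "b \<notin> T" "search_path L b" and a: "a \<in> T"
    and lower: "\<And>c. c \<in> T \<Longrightarrow> inorder_pos c < inorder_pos a \<Longrightarrow> a \<in> L \<Longrightarrow> c \<in> L"
    and greater: "inorder_pos b < inorder_pos a"
  shows "a \<notin> L"
proof -
  consider (below) "prefix (a @ [Left]) b" | (meet) p where "prefix (p @ [Left]) b" "prefix (p @ [Right]) a"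
    using greater not_below_leaf[OF T b(1) a] by (auto simp: inorder_pos_less_iff)
  then show ?thesis
  proof cases
    case below
    then show ?thesis
      using b(2) by (auto simp: search_path_def)
  next
    case (meet p)
    then have "p \<notin> L" "p \<in> T" "inorder_pos p < inorder_pos a"
      using b(2) T a prefix_snocD[OF meet(2)]
      by (auto simp: search_path_def inorder_pos_less_iff binary_tree_def strict_prefix_def)
    then show ?thesis
      using lower by blast
  qed
qed

lemma leaf_at_cut_exists:
  assumes T: "binary_tree T"
    and lower: "\<And>a c. c \<in> L \<Longrightarrow> a \<in> T \<Longrightarrow> inorder_pos a < inorder_pos c \<Longrightarrow> a \<in> L"
  shows "\<exists>b. b \<notin> T \<and> (\<forall>a. strict_prefix a b \<longrightarrow> a \<in> T) \<and>
    (\<forall>a\<in>T. inorder_pos a < inorder_pos b \<longleftrightarrow> a \<in> L)"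
proof -
  obtain b where b: "b \<notin> T" "\<And>a. strict_prefix a b \<Longrightarrow> a \<in> T" "search_path L b"
    using search_path_leaf_exists[OF T] by metis
  have "inorder_pos a < inorder_pos b \<longleftrightarrow> a \<in> L" if a: "a \<in> T" for a
  proof -
    have "a \<noteq> b"
      using a b(1) by blast
    then have "inorder_pos a < inorder_pos b \<or> inorder_pos b < inorder_pos a"
      by (simp flip: neq_iff)
    then show ?thesis
      using less_search_path_leafD[OF T b(1,3) a] greater_search_path_leafD[OF T b(1,3) a] lower a
      by blast
  qed
  with b(1,2) show ?thesis
    by blast
qed

lemma leaf_determined_by_cut:
  assumes "b \<notin> T" "b' \<notin> T" "\<And>a. strict_prefix a b \<Longrightarrow> a \<in> T" "\<And>a. strict_prefix a b' \<Longrightarrow> a \<in> T"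
    and "\<And>a. a \<in> T \<Longrightarrow> inorder_pos a < inorder_pos b \<longleftrightarrow> inorder_pos a < inorder_pos b'"
  shows "b = b'"
proof -
  have False
    if less: "inorder_pos b < inorder_pos b'" and leaf: "b \<notin> T" "b' \<notin> T"
      and prefix_in: "\<And>a. strict_prefix a b \<or> strict_prefix a b' \<Longrightarrow> a \<in> T"
      and cut: "\<And>a. a \<in> T \<Longrightarrow> inorder_pos a < inorder_pos b \<longleftrightarrow> inorder_pos a < inorder_pos b'" for b b'
  proof -
    obtain p where p: "prefix (p @ [Left]) b" "prefix (p @ [Right]) b'"
      using less leaf prefix_in prefix_snocD[of b' Left b] prefix_snocD[of b Right b']
      by (auto simp: inorder_pos_less_iff)
    then have "p \<in> T" "inorder_pos b < inorder_pos p" "inorder_pos p < inorder_pos b'"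
      using prefix_in prefix_snocD[OF p(1)] by (auto simp: inorder_pos_less_iff)
    then show False
      using cut by fastforce
  qed
  from this[of b b'] this[of b' b] show ?thesis
    using assms by (metis inorder_pos_eq_iff linorder_less_linear)
qed

definition growth_sequence :: "nat \<Rightarrow> (nat \<Rightarrow> vertex) \<Rightarrow> bool" where
  "growth_sequence k \<tau> \<longleftrightarrow>
     inj_on \<tau> {1..k} \<and> (\<forall>i\<in>{1..k}. \<forall>a. strict_prefix a (\<tau> i) \<longrightarrow> a \<in> \<tau> ` {1..<i})"

lemma growth_sequence_inj: "growth_sequence k \<tau> \<Longrightarrow> inj_on \<tau> {1..k}"
  by (simp add: growth_sequence_def)

lemma growth_sequence_prefix:
  "growth_sequence k \<tau> \<Longrightarrow> i \<in> {1..k} \<Longrightarrow> strict_prefix a (\<tau> i) \<Longrightarrow> a \<in> \<tau> ` {1..<i}"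
  by (simp add: growth_sequence_def)

lemma growth_sequence_fresh: "growth_sequence k \<tau> \<Longrightarrow> i \<in> {1..k} \<Longrightarrow> \<tau> i \<notin> \<tau> ` {1..<i}"
  using growth_sequence_inj[of k \<tau>] by (force dest: inj_onD)

lemma growth_sequence_Suc:
  assumes "growth_sequence k \<tau>" "b \<notin> \<tau> ` {1..k}" "\<And>a. strict_prefix a b \<Longrightarrow> a \<in> \<tau> ` {1..k}"
  shows "growth_sequence (Suc k) (\<tau>(Suc k := b))" (is "growth_sequence _ ?\<tau>")
proof -
  have "inj_on ?\<tau> (insert (Suc k) {1..k})"
    using growth_sequence_inj[OF assms(1)] assms(2) unfolding inj_on_insert
    by (intro conjI inj_on_fun_updI) auto
  then have "inj_on ?\<tau> {1..Suc k}"
    by (simp add: atLeastAtMostSuc_conv)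
  moreover have "a \<in> ?\<tau> ` {1..<i}" if "i \<in> {1..Suc k}" "strict_prefix a (?\<tau> i)" for i a
  proof -
    have "?\<tau> ` {1..<i} = \<tau> ` {1..<i}"
      using that(1) by auto
    then show ?thesis
      using that assms(3) growth_sequence_prefix[OF assms(1), of i a]
      by (cases "i = Suc k") (auto simp: atLeastLessThanSuc_atLeastAtMost)
  qed
  ultimately show ?thesis
    unfolding growth_sequence_def by blast
qed

lemma binary_tree_growth_sequence:
  assumes "growth_sequence k \<tau>"
  shows "binary_tree (\<tau> ` {1..k})"
  unfolding binary_tree_def
proof (intro conjI ballI allI impI)
  fix b a assume "b \<in> \<tau> ` {1..k}" "prefix a b"
  then obtain i where "i \<in> {1..k}" "a = \<tau> i \<or> strict_prefix a (\<tau> i)"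
    by (auto simp: prefix_order.le_less)
  then show "a \<in> \<tau> ` {1..k}"
    using growth_sequence_prefix[OF assms, of i a] by fastforce
qed simp

lemma increasing_labeling_growth_sequence:
  assumes \<tau>: "growth_sequence k \<tau>" and \<sigma>: "\<And>i. i \<in> {1..k} \<Longrightarrow> \<sigma> (\<tau> i) = i"
  shows "increasing_labeling k (\<tau> ` {1..k}) \<sigma>"
  unfolding increasing_labeling_def
proof (intro conjI ballI impI)
  show "bij_betw \<sigma> (\<tau> ` {1..k}) {1..k}"
    by (rule bij_betw_byWitness[where f' = \<tau>]) (use \<sigma> in auto)
next
  fix a b assume "a \<in> \<tau> ` {1..k}" "b \<in> \<tau> ` {1..k}" and prefix: "prefix a b"
  then obtain j where j: "j \<in> {1..k}" "b = \<tau> j" by blast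
  show "\<sigma> a \<le> \<sigma> b"
  proof (cases "a = b")
    case False
    then obtain i where "i \<in> {1..<j}" "a = \<tau> i"
      using growth_sequence_prefix[OF \<tau> j(1), of a] prefix j(2) by (auto simp: strict_prefix_def)
    then show ?thesis
      using \<sigma> j by simp
  qed simp
qed

lemma growth_sequence_inv_labeling:
  assumes T: "binary_tree T" and \<sigma>: "increasing_labeling k T \<sigma>"
  shows "growth_sequence k (inv_into T \<sigma>)"
  unfolding growth_sequence_def
proof (intro conjI ballI allI impI)
  have bij: "bij_betw \<sigma> T {1..k}"
    using \<sigma> by (simp add: increasing_labeling_def)
  then show "inj_on (inv_into T \<sigma>) {1..k}"
    by (simp add: bij_betw_def inj_on_inv_into)
  fix i a assume i: "i \<in> {1..k}" and a: "strict_prefix a (inv_into T \<sigma> i)"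
  have inv: "inv_into T \<sigma> i \<in> T" "\<sigma> (inv_into T \<sigma> i) = i"
    using i bij by (metis bij_betw_def inv_into_into, metis bij_betw_inv_into_right)
  then have "a \<in> T"
    using T a by (auto simp: binary_tree_def strict_prefix_def)
  moreover have "\<sigma> a \<le> i"
    using \<sigma> a inv \<open>a \<in> T\<close> unfolding increasing_labeling_def strict_prefix_def by metis
  moreover have "a = inv_into T \<sigma> (\<sigma> a)" "\<sigma> a \<in> {1..k}"
    using \<open>a \<in> T\<close> bij by (auto simp: bij_betw_def)
  ultimately show "a \<in> inv_into T \<sigma> ` {1..<i}"
    using a by (auto simp: strict_prefix_def le_less intro!: image_eqI[of _ _ "\<sigma> a"])
qed

definition inorder_matches :: "nat \<Rightarrow> (nat \<Rightarrow> vertex) \<Rightarrow> (nat \<Rightarrow> 'b::ord) \<Rightarrow> bool" where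
  "inorder_matches k \<tau> G \<longleftrightarrow>
     (\<forall>i\<in>{1..k}. \<forall>j\<in>{1..k}. inorder_pos (\<tau> i) < inorder_pos (\<tau> j) \<longleftrightarrow> G i < G j)"

lemma inorder_matchesD:
  "inorder_matches k \<tau> G \<Longrightarrow> i \<in> {1..k} \<Longrightarrow> j \<in> {1..k} \<Longrightarrow>
    inorder_pos (\<tau> i) < inorder_pos (\<tau> j) \<longleftrightarrow> G i < G j"
  by (simp add: inorder_matches_def)

lemma growth_sequence_unique:
  assumes growth: "growth_sequence k \<tau>" "growth_sequence k \<tau>'"
    and order: "inorder_matches k \<tau> G" "inorder_matches k \<tau>' G"
    and "i \<in> {1..k}"
  shows "\<tau> i = \<tau>' i"
  using assms(5)
proof (induction i rule: less_induct)
  case (less i)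
  then have IH: "\<tau> j = \<tau>' j" if "j \<in> {1..<i}" for j
    using that by simp
  then have image: "\<tau>' ` {1..<i} = \<tau> ` {1..<i}"
    by simp
  show ?case
  proof (rule leaf_determined_by_cut[where T = "\<tau> ` {1..<i}"])
    fix a assume "a \<in> \<tau> ` {1..<i}"
    then obtain j where j: "j \<in> {1..<i}" "a = \<tau> j" "a = \<tau>' j"
      using IH by auto
    then have "j \<in> {1..k}"
      using less.prems by auto
    then show "inorder_pos a < inorder_pos (\<tau> i) \<longleftrightarrow> inorder_pos a < inorder_pos (\<tau>' i)"
      using inorder_matchesD[OF order(1), of j i] inorder_matchesD[OF order(2), of j i] j less.prems by metis
  qed (use less.prems growth growth_sequence_fresh growth_sequence_prefix image in \<open>metis+\<close>)
qed

lemma growth_sequence_extend: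
  fixes G :: "nat \<Rightarrow> 'b::order"
  assumes \<tau>: "growth_sequence k \<tau>" and order: "inorder_matches k \<tau> G"
    and comparable: "\<And>j. j \<in> {1..k} \<Longrightarrow> G j < G (Suc k) \<or> G (Suc k) < G j"
  shows "\<exists>b. growth_sequence (Suc k) (\<tau>(Suc k := b)) \<and> inorder_matches (Suc k) (\<tau>(Suc k := b)) G"
proof -
  define L where "L = \<tau> ` {j \<in> {1..k}. G j < G (Suc k)}"
  have L_iff: "\<tau> j \<in> L \<longleftrightarrow> G j < G (Suc k)" if "j \<in> {1..k}" for j
    unfolding L_def using that growth_sequence_inj[OF \<tau>] by (subst inj_on_image_mem_iff) auto
  have "a \<in> L" if "c \<in> L" "a \<in> \<tau> ` {1..k}" "inorder_pos a < inorder_pos c" for a c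
    using that order by (fastforce simp: L_def inorder_matches_def)
  then have "\<exists>b. b \<notin> \<tau> ` {1..k} \<and> (\<forall>a. strict_prefix a b \<longrightarrow> a \<in> \<tau> ` {1..k}) \<and>
      (\<forall>a\<in>\<tau> ` {1..k}. inorder_pos a < inorder_pos b \<longleftrightarrow> a \<in> L)"
    by (rule leaf_at_cut_exists[OF binary_tree_growth_sequence[OF \<tau>]])
  then obtain b where leaf: "b \<notin> \<tau> ` {1..k}" "\<And>a. strict_prefix a b \<Longrightarrow> a \<in> \<tau> ` {1..k}"
    and cut: "\<And>a. a \<in> \<tau> ` {1..k} \<Longrightarrow> inorder_pos a < inorder_pos b \<longleftrightarrow> a \<in> L"
    by blast
  have less_b: "inorder_pos (\<tau> j) < inorder_pos b \<longleftrightarrow> G j < G (Suc k)" if "j \<in> {1..k}" for j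
    using cut L_iff that by simp
  have "inorder_pos b < inorder_pos (\<tau> j) \<longleftrightarrow> G (Suc k) < G j" if j: "j \<in> {1..k}" for j
  proof -
    have "\<tau> j \<noteq> b"
      using leaf(1) j by blast
    then have "inorder_pos b < inorder_pos (\<tau> j) \<longleftrightarrow> \<not> inorder_pos (\<tau> j) < inorder_pos b"
      by (metis inorder_pos_eq_iff linorder_less_linear order_less_asym)
    then show ?thesis
      using less_b[OF j] comparable[OF j] by auto
  qed
  with less_b order have "inorder_matches (Suc k) (\<tau>(Suc k := b)) G"
    by (auto simp: inorder_matches_def le_Suc_eq)
  moreover have "growth_sequence (Suc k) (\<tau>(Suc k := b))"
    using \<tau> leaf by (rule growth_sequence_Suc)
  ultimately show ?thesis
    by blast
qed

lemma growth_sequence_exists: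
  fixes G :: "nat \<Rightarrow> 'b::order"
  assumes "\<And>i j. i \<in> {1..k} \<Longrightarrow> j \<in> {1..<i} \<Longrightarrow> G j < G i \<or> G i < G j"
  shows "\<exists>\<tau>. growth_sequence k \<tau> \<and> inorder_matches k \<tau> G"
  using assms
proof (induction k)
  case 0
  then show ?case by (simp add: growth_sequence_def inorder_matches_def)
next
  case (Suc k)
  then obtain \<tau> where "growth_sequence k \<tau>" "inorder_matches k \<tau> G"
    by (metis atLeastAtMost_iff le_Suc_eq)
  moreover have "G j < G (Suc k) \<or> G (Suc k) < G j" if "j \<in> {1..k}" for j
    using Suc.prems[of "Suc k" j] that by auto
  ultimately show ?case
    using growth_sequence_extend by blast
qed

section \<open>Trees and sequences of comparable flats\<close>

definition union_below :: "'a set set \<Rightarrow> 'a set \<Rightarrow> 'a set" where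
  "union_below C S = \<Union>{H \<in> C. H \<subset> S}"

definition inter_above :: "'a set \<Rightarrow> 'a set set \<Rightarrow> 'a set \<Rightarrow> 'a set" where
  "inter_above E C S = E \<inter> \<Inter>{H \<in> C. S \<subset> H}"

definition compatible_extensions :: "'a set_system \<Rightarrow> 'a set set \<Rightarrow> nat \<Rightarrow> 'a set set" where
  "compatible_extensions M C m =
     {S \<in> proper_flats M. (\<forall>H\<in>C. H \<subset> S \<or> S \<subset> H) \<and>
        card (union_below C S) < m \<and> m < card (inter_above (ground M) C S)}"

definition compatible_seqs :: "'a set_system \<Rightarrow> nat \<Rightarrow> (nat \<Rightarrow> nat) \<Rightarrow> (nat \<Rightarrow> 'a set) set" where
  "compatible_seqs M k v =
     {G \<in> extensional {1..k}. \<forall>i\<in>{1..k}. G i \<in> compatible_extensions M (G ` {1..<i}) (v i)}"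

definition flats_by_label ::
  "nat \<Rightarrow> vertex set \<times> (vertex \<Rightarrow> nat) \<times> (vertex \<Rightarrow> 'a set) \<Rightarrow> nat \<Rightarrow> 'a set" where
  "flats_by_label k = (\<lambda>(T, \<sigma>, F). restrict (\<lambda>i. F (inv_into T \<sigma> i)) {1..k})"

lemma compatible_seqs_comparable:
  assumes "G \<in> compatible_seqs M k v" "i \<in> {1..k}" "j \<in> {1..<i}"
  shows "G j \<subset> G i \<or> G i \<subset> G j"
  using assms by (auto simp: compatible_seqs_def compatible_extensions_def)

lemma compatible_seqs_subset_PiE: "compatible_seqs M k v \<subseteq> {1..k} \<rightarrow>\<^sub>E proper_flats M"
  by (auto simp: compatible_seqs_def compatible_extensions_def PiE_def)

lemma flat_left_eq_Union:
  assumes tree: "binary_tree (subtree_upto T \<sigma> (\<sigma> b))"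
    and mono: "\<And>a c. (a, c) \<in> search_order (subtree_upto T \<sigma> (\<sigma> b)) \<Longrightarrow> F a \<subseteq> F c"
  shows "flat_left T \<sigma> F b = \<Union>(F ` {a. (a, b) \<in> search_order (subtree_upto T \<sigma> (\<sigma> b))})"
proof (cases "\<exists>c. (c, b) \<in> search_order (subtree_upto T \<sigma> (\<sigma> b))")
  case True
  define r where "r = search_order (subtree_upto T \<sigma> (\<sigma> b))"
  obtain c where "(c, b) \<in> r"
    using True by (auto simp: r_def)
  with strict_linear_order_on_search_order[OF tree] search_order_subset[OF tree] finite_binary_tree[OF tree]
  obtain a where a: "(a, b) \<in> r" "(THE a. covers r a b) = a"
    "\<And>c. (c, b) \<in> r \<Longrightarrow> c = a \<or> (c, a) \<in> r"
    unfolding r_def by (rule immediate_predecessor) blast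
  have "\<Union>(F ` {a. (a, b) \<in> r}) = F a"
    using a(1,3) mono by (fastforce simp: r_def)
  then show ?thesis
    using a(1,2) by (auto simp: flat_left_def r_def Let_def)
qed (simp add: flat_left_def)

lemma flat_right_eq_Inter:
  assumes tree: "binary_tree (subtree_upto T \<sigma> (\<sigma> b))"
    and mono: "\<And>a c. (a, c) \<in> search_order (subtree_upto T \<sigma> (\<sigma> b)) \<Longrightarrow> F a \<subseteq> F c"
    and ground: "\<And>a. a \<in> T \<Longrightarrow> F a \<subseteq> ground M"
  shows "flat_right M T \<sigma> F b =
    ground M \<inter> \<Inter>(F ` {a. (b, a) \<in> search_order (subtree_upto T \<sigma> (\<sigma> b))})"
proof (cases "\<exists>c. (b, c) \<in> search_order (subtree_upto T \<sigma> (\<sigma> b))")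
  case True
  define r where "r = search_order (subtree_upto T \<sigma> (\<sigma> b))"
  obtain c where "(b, c) \<in> r"
    using True by (auto simp: r_def)
  with strict_linear_order_on_search_order[OF tree] search_order_subset[OF tree] finite_binary_tree[OF tree]
  obtain a where a: "(b, a) \<in> r" "(THE a. covers r b a) = a"
    "\<And>c. (b, c) \<in> r \<Longrightarrow> c = a \<or> (a, c) \<in> r"
    unfolding r_def by (rule immediate_successor) blast
  have "F a \<subseteq> ground M"
    using a(1) ground unfolding r_def search_order_eq[OF tree] by (simp add: subtree_upto_def)
  then have "ground M \<inter> \<Inter>(F ` {a. (b, a) \<in> r}) = F a"
    using a(1,3) mono by (fastforce simp: r_def)
  then show ?thesis
    using a(1,2) by (auto simp: flat_right_def r_def Let_def)
qed (simp add: flat_right_def)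

locale flat_filled_tree =
  fixes M :: "'a set_system" and k :: nat and T :: "vertex set"
    and \<sigma> :: "vertex \<Rightarrow> nat" and F :: "vertex \<Rightarrow> 'a set"
  assumes tree: "binary_tree T" and labeling: "increasing_labeling k T \<sigma>"
    and filling: "flat_filling M T F"
begin

abbreviation vert :: "nat \<Rightarrow> vertex" where
  "vert \<equiv> inv_into T \<sigma>"

abbreviation flats :: "nat \<Rightarrow> 'a set" where
  "flats \<equiv> flats_by_label k (T, \<sigma>, F)"

lemma bij_label: "bij_betw \<sigma> T {1..k}"
  using labeling by (simp add: increasing_labeling_def)

lemma bij_vert: "bij_betw vert {1..k} T"
  using bij_label by (rule bij_betw_inv_into)

lemma vert_image: "vert ` {1..k} = T"
  using bij_vert by (simp add: bij_betw_def)

lemma vert_in_tree: "i \<in> {1..k} \<Longrightarrow> vert i \<in> T"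
  using vert_image by blast

lemma label_vert [simp]: "i \<in> {1..k} \<Longrightarrow> \<sigma> (vert i) = i"
  by (rule bij_betw_inv_into_right[OF bij_label])

lemma growth_sequence_vert: "growth_sequence k vert"
  using tree labeling by (rule growth_sequence_inv_labeling)

lemma flats_eq: "i \<in> {1..k} \<Longrightarrow> flats i = F (vert i)"
  by (simp add: flats_by_label_def)

lemma flats_image: "flats ` {1..k} = F ` T"
proof -
  have "flats ` {1..k} = F ` vert ` {1..k}"
    by (simp add: flats_eq image_image)
  then show ?thesis
    by (simp only: vert_image)
qed

lemma flats_proper: "i \<in> {1..k} \<Longrightarrow> flats i \<in> proper_flats M"
  using filling vert_in_tree by (auto simp: flats_eq flat_filling_def)

lemma filling_less: "a \<in> T \<Longrightarrow> b \<in> T \<Longrightarrow> inorder_pos a < inorder_pos b \<Longrightarrow> F a \<subset> F b"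
  using filling by (auto simp: flat_filling_def search_order_eq[OF tree])

lemma flats_less_iff:
  assumes "i \<in> {1..k}" "j \<in> {1..k}"
  shows "flats i \<subset> flats j \<longleftrightarrow> inorder_pos (vert i) < inorder_pos (vert j)"
  using filling_less[of "vert i" "vert j"] filling_less[of "vert j" "vert i"] assms
  by (cases "inorder_pos (vert i)" "inorder_pos (vert j)" rule: linorder_cases)
    (auto simp: flats_eq vert_in_tree)

lemma inorder_matches_vert: "inorder_matches k vert flats"
  by (simp add: inorder_matches_def flats_less_iff)

lemma flats_comparable:
  assumes "i \<in> {1..k}" "j \<in> {1..<i}"
  shows "flats j \<subset> flats i \<or> flats i \<subset> flats j"
proof -
  have "vert j \<noteq> vert i"
    using growth_sequence_fresh[OF growth_sequence_vert assms(1)] assms(2) by (metis imageI)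
  then show ?thesis
    using assms flats_less_iff[of i j] flats_less_iff[of j i]
    by (auto simp: neq_iff simp flip: inorder_pos_eq_iff)
qed

lemma subtree_upto_label:
  assumes "i \<in> {1..k}"
  shows "subtree_upto T \<sigma> i = vert ` {1..i}"
proof -
  have "subtree_upto T \<sigma> i = vert ` {j \<in> {1..k}. j \<le> i}"
    unfolding subtree_upto_def by (subst vert_image[symmetric]) auto
  also have "{j \<in> {1..k}. j \<le> i} = {1..i}"
    using assms by auto
  finally show ?thesis .
qed

lemma binary_tree_subtree_upto: "binary_tree (subtree_upto T \<sigma> i)"
  using tree labeling unfolding binary_tree_def increasing_labeling_def subtree_upto_def
  by auto (meson le_trans)

lemma search_order_subtree_upto_less:
  "(a, b) \<in> search_order (subtree_upto T \<sigma> i) \<Longrightarrow> F a \<subset> F b"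
  using filling_less unfolding search_order_eq[OF binary_tree_subtree_upto] by (simp add: subtree_upto_def)

lemma predecessors:
  assumes "i \<in> {1..k}"
  shows "{a. (a, vert i) \<in> search_order (subtree_upto T \<sigma> i)} = vert ` {j \<in> {1..<i}. flats j \<subset> flats i}"
proof -
  have "{j \<in> {1..<i}. flats j \<subset> flats i} = {j \<in> {1..i}. inorder_pos (vert j) < inorder_pos (vert i)}"
    using assms by (auto simp: flats_less_iff le_less del: psubsetI)
  then show ?thesis
    unfolding search_order_eq[OF binary_tree_subtree_upto] unfolding subtree_upto_label[OF assms]
    using assms by auto
qed

lemma successors:
  assumes "i \<in> {1..k}"
  shows "{a. (vert i, a) \<in> search_order (subtree_upto T \<sigma> i)} = vert ` {j \<in> {1..<i}. flats i \<subset> flats j}"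
proof -
  have "{j \<in> {1..<i}. flats i \<subset> flats j} = {j \<in> {1..i}. inorder_pos (vert i) < inorder_pos (vert j)}"
    using assms by (auto simp: flats_less_iff le_less del: psubsetI)
  then show ?thesis
    unfolding search_order_eq[OF binary_tree_subtree_upto] unfolding subtree_upto_label[OF assms]
    using assms by auto
qed

lemma flat_left_vert:
  assumes "i \<in> {1..k}"
  shows "flat_left T \<sigma> F (vert i) = union_below (flats ` {1..<i}) (flats i)"
proof -
  have "flat_left T \<sigma> F (vert i) = \<Union>(F ` vert ` {j \<in> {1..<i}. flats j \<subset> flats i})"
    using flat_left_eq_Union[of T \<sigma> "vert i" F] binary_tree_subtree_upto
      psubset_imp_subset[OF search_order_subtree_upto_less] assms
    by (simp add: predecessors)
  also have "F ` vert ` {j \<in> {1..<i}. flats j \<subset> flats i} = flats ` {j \<in> {1..<i}. flats j \<subset> flats i}"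
    using assms by (simp add: image_image flats_eq)
  also have "\<dots> = {H \<in> flats ` {1..<i}. H \<subset> flats i}"
    by blast
  finally show ?thesis
    by (simp add: union_below_def)
qed

lemma flat_right_vert:
  assumes "i \<in> {1..k}"
  shows "flat_right M T \<sigma> F (vert i) = inter_above (ground M) (flats ` {1..<i}) (flats i)"
proof -
  have "F a \<subseteq> ground M" if "a \<in> T" for a
    using filling that by (auto simp: flat_filling_def proper_flats_def flat_def)
  then have "flat_right M T \<sigma> F (vert i) = ground M \<inter> \<Inter>(F ` vert ` {j \<in> {1..<i}. flats i \<subset> flats j})"
    using flat_right_eq_Inter[of T \<sigma> "vert i" F M] binary_tree_subtree_upto
      psubset_imp_subset[OF search_order_subtree_upto_less] assms
    by (simp add: successors)
  also have "F ` vert ` {j \<in> {1..<i}. flats i \<subset> flats j} = flats ` {j \<in> {1..<i}. flats i \<subset> flats j}"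
    using assms by (simp add: image_image flats_eq)
  also have "\<dots> = {H \<in> flats ` {1..<i}. flats i \<subset> H}"
    by blast
  finally show ?thesis
    by (simp add: inter_above_def)
qed

lemma flats_compatible_iff: "flats \<in> compatible_seqs M k v \<longleftrightarrow> compatible M v T \<sigma> F"
proof -
  have "flats i \<in> compatible_extensions M (flats ` {1..<i}) (v i) \<longleftrightarrow>
      card (flat_left T \<sigma> F (vert i)) < v i \<and> v i < card (flat_right M T \<sigma> F (vert i))"
    if "i \<in> {1..k}" for i
    using that flats_proper flats_comparable
    by (auto simp: compatible_extensions_def flat_left_vert flat_right_vert)
  moreover have "compatible M v T \<sigma> F \<longleftrightarrow> (\<forall>b\<in>vert ` {1..k}.
      card (flat_left T \<sigma> F b) < v (\<sigma> b) \<and> v (\<sigma> b) < card (flat_right M T \<sigma> F b))"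
    unfolding vert_image compatible_def ..
  ultimately show ?thesis
    by (simp add: compatible_seqs_def flats_by_label_def)
qed

end

lemma compatible_trees_iff:
  "(T, \<sigma>, F) \<in> compatible_trees M k v \<longleftrightarrow>
     flat_filled_tree M k T \<sigma> F \<and> \<sigma> \<in> extensional T \<and> F \<in> extensional T \<and> compatible M v T \<sigma> F"
  by (auto simp: compatible_trees_def flat_filled_tree_def)

lemma inj_on_flats_by_label:
  fixes M :: "'a set_system"
  shows "inj_on (flats_by_label k) (compatible_trees M k v)"
proof (rule inj_onI)
  fix t t' :: "vertex set \<times> (vertex \<Rightarrow> nat) \<times> (vertex \<Rightarrow> 'a set)"
  assume trees: "t \<in> compatible_trees M k v" "t' \<in> compatible_trees M k v"
    and eq: "flats_by_label k t = flats_by_label k t'"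
  obtain T \<sigma> F T' \<sigma>' F' where t_def: "t = (T, \<sigma>, F)" and t'_def: "t' = (T', \<sigma>', F')"
    by (cases t, cases t')
  note t = trees[unfolded t_def t'_def] and flats_eq = eq[unfolded t_def t'_def]
  interpret A: flat_filled_tree M k T \<sigma> F
    using t by (simp add: compatible_trees_iff)
  interpret B: flat_filled_tree M k T' \<sigma>' F'
    using t by (simp add: compatible_trees_iff)
  have vert_eq: "A.vert i = B.vert i" if "i \<in> {1..k}" for i
    using A.growth_sequence_vert B.growth_sequence_vert A.inorder_matches_vert
      B.inorder_matches_vert[folded flats_eq] that
    by (rule growth_sequence_unique)
  then have "T = T'"
    using A.vert_image B.vert_image by (metis (no_types, lifting) image_cong)
  moreover have "\<sigma> a = \<sigma>' a" "F a = F' a" if a: "a \<in> T" for a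
  proof -
    obtain i where i: "i \<in> {1..k}" "a = A.vert i"
      using a A.vert_image by blast
    show "\<sigma> a = \<sigma>' a"
      using i A.label_vert B.label_vert vert_eq by metis
    show "F a = F' a"
      using i A.flats_eq B.flats_eq vert_eq flats_eq by metis
  qed
  ultimately show "t = t'"
    using t by (auto simp: t_def t'_def compatible_trees_iff intro: extensionalityI)
qed

lemma tree_of_growth_sequence:
  fixes k :: nat and \<tau> :: "nat \<Rightarrow> vertex" and G :: "nat \<Rightarrow> 'a set"
  defines "T \<equiv> \<tau> ` {1..k}"
  defines "\<sigma> \<equiv> restrict (inv_into {1..k} \<tau>) T"
  defines "F \<equiv> restrict (\<lambda>a. G (\<sigma> a)) T"
  assumes \<tau>: "growth_sequence k \<tau>"
    and order: "inorder_matches k \<tau> G"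
    and G: "G \<in> {1..k} \<rightarrow>\<^sub>E proper_flats M"
  shows "flat_filled_tree M k T \<sigma> F" "flats_by_label k (T, \<sigma>, F) = G"
proof -
  have \<sigma>_\<tau>: "\<sigma> (\<tau> i) = i" and F_\<tau>: "F (\<tau> i) = G i" if "i \<in> {1..k}" for i
    using that growth_sequence_inj[OF \<tau>] by (simp_all add: \<sigma>_def T_def F_def)
  have tree: "binary_tree T"
    unfolding T_def using \<tau> by (rule binary_tree_growth_sequence)
  have labeling: "increasing_labeling k T \<sigma>"
    unfolding T_def using \<tau> \<sigma>_\<tau> by (rule increasing_labeling_growth_sequence)
  have "flat_filling M T F"
    unfolding flat_filling_def search_order_eq[OF tree]
    using G order F_\<tau> by (auto simp: T_def inorder_matches_def)
  with tree labeling show "flat_filled_tree M k T \<sigma> F"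
    by unfold_locales
  have inj: "inj_on \<sigma> T"
    using labeling by (simp add: increasing_labeling_def bij_betw_def)
  have vert: "inv_into T \<sigma> i = \<tau> i" if "i \<in> {1..k}" for i
    using inv_into_f_f[OF inj, of "\<tau> i"] \<sigma>_\<tau>[OF that] that by (simp add: T_def)
  show "flats_by_label k (T, \<sigma>, F) = G"
  proof (rule extensionalityI)
    show "flats_by_label k (T, \<sigma>, F) \<in> extensional {1..k}"
      by (simp add: flats_by_label_def)
    show "G \<in> extensional {1..k}"
      using G by (simp add: PiE_def)
    show "flats_by_label k (T, \<sigma>, F) i = G i" if "i \<in> {1..k}" for i
      using vert[OF that] F_\<tau>[OF that] that by (simp add: flats_by_label_def)
  qed
qed

lemma flats_by_label_surj:
  assumes G: "G \<in> compatible_seqs M k v"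
  shows "G \<in> flats_by_label k ` compatible_trees M k v"
proof -
  obtain \<tau> where \<tau>: "growth_sequence k \<tau>" "inorder_matches k \<tau> G"
    using growth_sequence_exists[of k G] compatible_seqs_comparable[OF G] by metis
  define T where "T = \<tau> ` {1..k}"
  define \<sigma> where "\<sigma> = restrict (inv_into {1..k} \<tau>) T"
  define F where "F = restrict (\<lambda>a. G (\<sigma> a)) T"
  have tree: "flat_filled_tree M k T \<sigma> F" and flats: "flats_by_label k (T, \<sigma>, F) = G"
    unfolding F_def \<sigma>_def T_def
    using tree_of_growth_sequence[OF \<tau> subsetD[OF compatible_seqs_subset_PiE G]] by simp_all
  have "compatible M v T \<sigma> F"
    using flat_filled_tree.flats_compatible_iff[OF tree, of v] flats G by simp
  with tree have "(T, \<sigma>, F) \<in> compatible_trees M k v"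
    by (simp add: compatible_trees_iff \<sigma>_def F_def)
  then show ?thesis
    using flats by blast
qed

lemma bij_betw_flats_by_label:
  "bij_betw (flats_by_label k) (compatible_trees M k v) (compatible_seqs M k v)"
proof -
  have "flats_by_label k t \<in> compatible_seqs M k v" if "t \<in> compatible_trees M k v" for t
    using that by (cases t) (simp add: compatible_trees_iff flat_filled_tree.flats_compatible_iff)
  then show ?thesis
    using inj_on_flats_by_label flats_by_label_surj by (auto simp: bij_betw_def)
qed

section \<open>Coefficients as deficits of weights\<close>

definition deficit :: "('a \<Rightarrow> real) \<Rightarrow> nat \<Rightarrow> 'a set \<Rightarrow> real" where
  "deficit w m S = min (real (card S)) (real m) - sum w S"

text \<open>The set \<open>D\<close> stands for the gap \<open>B - A\<close> between two consecutive members of a chain, \<open>X\<close> for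
  \<open>S - A\<close> and \<open>j\<close> for the mass \<open>m - |A|\<close> that remains to be placed in the gap.\<close>

definition deficit_coefficient :: "('a set \<Rightarrow> 'a set \<Rightarrow> nat \<Rightarrow> real) \<Rightarrow> bool" where
  "deficit_coefficient \<kappa> \<longleftrightarrow>
     (\<forall>D j. finite D \<longrightarrow> j \<le> card D \<longrightarrow>
        (\<exists>u. sum u D = real j \<and> (\<forall>X\<subseteq>D. \<kappa> D X j = deficit u j X)))"

lemma deficit_coefficient_mlt: "deficit_coefficient (\<lambda>D X j. mlt D (card X) (int j))"
  unfolding deficit_coefficient_def
proof (intro allI impI)
  fix D :: "'a set" and j :: nat
  assume "finite D" "j \<le> card D"
  then have "sum (\<lambda>_. real j / real (card D)) D = real j"
    by (cases "card D = 0") auto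
  moreover have "mlt D (card X) (int j) = deficit (\<lambda>_. real j / real (card D)) j X" for X
    by (simp add: mlt_def deficit_def min_def)
  ultimately show "\<exists>u. sum u D = real j \<and> (\<forall>X\<subseteq>D. mlt D (card X) (int j) = deficit u j X)"
    by blast
qed

lemma card_largest:
  fixes D :: "'a::linorder set"
  assumes "finite D" "j \<le> card D"
  shows "card (largest j D) = j"
proof -
  define r where "r x = card {y \<in> D. x < y}" for x
  have less: "r y < r x" if "x < y" "y \<in> D" for x y
    unfolding r_def using assms(1) that by (intro psubset_card_mono) auto
  have inj: "inj_on r D"
    using less by (intro linorder_inj_onI) (fastforce, auto)
  have "r ` D \<subseteq> {..<card D}"
    unfolding r_def using assms(1) by (auto intro!: psubset_card_mono)
  then have "r ` D = {..<card D}"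
    using card_image[OF inj] by (intro card_subset_eq) auto
  moreover have "largest j D = {x \<in> D. r x < j}"
    by (simp add: largest_def r_def)
  ultimately have "r ` largest j D = {..<j}"
    using assms(2) by (auto simp: image_iff set_eq_iff) (metis lessThan_iff imageE order_less_le_trans)+
  then show ?thesis
    using card_image[OF inj_on_subset[OF inj, of "largest j D"]] by (auto simp: largest_def)
qed

lemma deficit_coefficient_OI:
  "deficit_coefficient (\<lambda>D X j. real_of_int (OI D X (largest (card D - j) D)))"
  unfolding deficit_coefficient_def
proof (intro allI impI)
  fix D :: "'a::linorder set" and j :: nat
  assume D: "finite D" "j \<le> card D"
  define U where "U = largest (card D - j) D"
  define u :: "'a \<Rightarrow> real" where "u = (\<lambda>e. if e \<in> U then 0 else 1)"
  have card_U: "card U = card D - j"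
    unfolding U_def using D by (intro card_largest) auto
  have "U \<subseteq> D"
    by (auto simp: U_def largest_def)
  have sum_u: "sum u X = real (card X) - real (card (X \<inter> U))" if "finite X" for X
  proof -
    have "sum u X = (\<Sum>e\<in>X. 1) - (\<Sum>e\<in>X. if e \<in> U then 1 else 0)"
      unfolding u_def sum_subtractf[symmetric] by (intro sum.cong) auto
    then show ?thesis
      using sum.inter_restrict[OF that, of "\<lambda>_. 1 :: real" U] by simp
  qed
  have "sum u D = real j"
    using sum_u[OF D(1)] \<open>U \<subseteq> D\<close> card_U D(2) by (simp add: inf_absorb2)
  moreover have "real_of_int (OI D X U) = deficit u j X" if "X \<subseteq> D" for X
    using sum_u[OF finite_subset[OF that D(1)]] card_U D(2)
    by (simp add: OI_def deficit_def min_def max_def)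
  ultimately show "\<exists>u. sum u D = real j \<and>
      (\<forall>X\<subseteq>D. real_of_int (OI D X (largest (card D - j) D)) = deficit u j X)"
    unfolding U_def by blast
qed

definition gap_weight :: "'a set \<Rightarrow> 'a set \<Rightarrow> ('a \<Rightarrow> real) \<Rightarrow> 'a \<Rightarrow> real" where
  "gap_weight A B u e = (if e \<in> A then 1 else if e \<in> B then u e else 0)"

lemma sum_gap_weight_below: "S \<subseteq> A \<Longrightarrow> sum (gap_weight A B u) S = real (card S)"
  by (simp add: gap_weight_def subset_iff)

lemma sum_gap_weight_between:
  assumes "finite S" "A \<subseteq> S" "S \<subseteq> B"
  shows "sum (gap_weight A B u) S = sum u (S - A) + real (card A)"
proof -
  have "sum (gap_weight A B u) (S - A) = sum u (S - A)"
    using assms(3) by (intro sum.cong) (auto simp: gap_weight_def)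
  then show ?thesis
    using sum.subset_diff[OF assms(2,1), of "gap_weight A B u"] sum_gap_weight_below[of A A B u] by simp
qed

lemma sum_gap_weight_above:
  assumes "finite S" "A \<subseteq> B" "B \<subseteq> S"
  shows "sum (gap_weight A B u) S = sum u (B - A) + real (card A)"
proof -
  have "sum (gap_weight A B u) (S - B) = 0"
    using assms(2) by (intro sum.neutral) (auto simp: gap_weight_def)
  then show ?thesis
    using sum.subset_diff[OF assms(3,1), of "gap_weight A B u"]
      sum_gap_weight_between[OF finite_subset[OF assms(3,1)] assms(2) order_refl, of u] by simp
qed

lemma gap_weight_exists:
  assumes \<kappa>: "deficit_coefficient \<kappa>" and E: "finite E"
    and gap: "A \<subseteq> B" "B \<subseteq> E" "card A \<le> m" "m \<le> card B"
  shows "\<exists>w. sum w E = real m \<and>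
    (\<forall>S. S \<subseteq> A \<or> B \<subseteq> S \<and> S \<subseteq> E \<longrightarrow> deficit w m S = 0) \<and>
    (\<forall>S. A \<subseteq> S \<and> S \<subseteq> B \<longrightarrow> deficit w m S = \<kappa> (B - A) (S - A) (m - card A))"
proof -
  have fin: "finite S" if "S \<subseteq> E" for S
    using that E by (rule finite_subset)
  have "m - card A \<le> card (B - A)" "finite (B - A)"
    using gap fin by (auto simp: card_Diff_subset)
  then obtain u where u: "sum u (B - A) = real (m - card A)"
    "\<And>X. X \<subseteq> B - A \<Longrightarrow> \<kappa> (B - A) X (m - card A) = deficit u (m - card A) X"
    using \<kappa> unfolding deficit_coefficient_def by metis
  let ?w = "gap_weight A B u"
  have mass: "sum ?w S = real m" if "B \<subseteq> S" "S \<subseteq> E" for S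
    using sum_gap_weight_above[OF fin[OF that(2)] gap(1) that(1), of u] u(1) gap(3) by simp
  show ?thesis
  proof (intro exI[of _ ?w] conjI allI impI)
    show "sum ?w E = real m"
      using gap(2) by (rule mass) simp
  next
    fix S assume "S \<subseteq> A \<or> B \<subseteq> S \<and> S \<subseteq> E"
    moreover have "deficit ?w m S = 0" if "S \<subseteq> A"
      using sum_gap_weight_below[OF that, of B u] card_mono[OF fin that] order_trans[OF gap(1,2)] gap(3)
      by (simp add: deficit_def)
    moreover have "deficit ?w m S = 0" if "B \<subseteq> S" "S \<subseteq> E"
      using mass[OF that] card_mono[OF fin that(1)] that gap by (simp add: deficit_def)
    ultimately show "deficit ?w m S = 0"
      by blast
  next
    fix S assume "A \<subseteq> S \<and> S \<subseteq> B"
    then have S: "A \<subseteq> S" "S \<subseteq> B"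
      by auto
    then have "card (S - A) = card S - card A" "card A \<le> card S"
      using gap fin[of A] fin[of S] by (auto simp: card_Diff_subset card_mono)
    then have "deficit ?w m S = deficit u (m - card A) (S - A)"
      using sum_gap_weight_between[OF fin S, of u] S(2) gap by (auto simp: deficit_def min_def)
    then show "deficit ?w m S = \<kappa> (B - A) (S - A) (m - card A)"
      using u(2)[OF Diff_mono[OF S(2) order_refl]] by simp
  qed
qed

section \<open>The gap of a chain\<close>

text \<open>If some member \<open>H\<close> of the chain \<open>C\<close> has exactly \<open>m\<close> elements, then both ends of the gap
  are \<open>H\<close>; this is why the two inequalities are not strict.\<close>

definition gap_bottom :: "'a set set \<Rightarrow> nat \<Rightarrow> 'a set" where
  "gap_bottom C m = \<Union>{H \<in> C. card H \<le> m}"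

definition gap_top :: "'a set \<Rightarrow> 'a set set \<Rightarrow> nat \<Rightarrow> 'a set" where
  "gap_top E C m = E \<inter> \<Inter>{H \<in> C. m \<le> card H}"

lemma gap_bottom_cases:
  assumes "finite C" "subset.chain X C"
  shows "gap_bottom C m = {} \<or> gap_bottom C m \<in> C \<and> card (gap_bottom C m) \<le> m"
proof (cases "{H \<in> C. card H \<le> m} = {}")
  case True
  then show ?thesis
    unfolding gap_bottom_def True by simp
next
  case False
  moreover have "subset.chain X {H \<in> C. card H \<le> m}"
    using assms(2) by (auto simp: subset_chain_def)
  ultimately have "gap_bottom C m \<in> {H \<in> C. card H \<le> m}"
    unfolding gap_bottom_def using assms(1) by (intro Union_in_chain) auto
  then show ?thesis by simp
qed

lemma gap_top_cases:
  assumes "finite C" "subset.chain (Pow E) C"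
  shows "gap_top E C m = E \<or> gap_top E C m \<in> C \<and> m \<le> card (gap_top E C m)"
proof (cases "{H \<in> C. m \<le> card H} = {}")
  case True
  then show ?thesis
    unfolding gap_top_def True by simp
next
  case False
  moreover have "subset.chain (Pow E) {H \<in> C. m \<le> card H}"
    using assms(2) by (auto simp: subset_chain_def)
  ultimately have Inter: "\<Inter>{H \<in> C. m \<le> card H} \<in> {H \<in> C. m \<le> card H}"
    using assms(1) by (intro Inter_in_chain) auto
  then have "gap_top E C m = \<Inter>{H \<in> C. m \<le> card H}"
    using assms(2) by (auto simp: gap_top_def subset_chain_def)
  then show ?thesis
    using Inter by simp
qed

lemma gap_bottom_subset_gap_top:
  assumes "finite E" "subset.chain (Pow E) C"
  shows "gap_bottom C m \<subseteq> gap_top E C m"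
proof -
  have "H \<subseteq> H'" if "H \<in> C" "card H \<le> m" "H' \<in> C" "m \<le> card H'" for H H'
  proof -
    have "finite H" "H \<subseteq> H' \<or> H' \<subseteq> H"
      using that(1,3) assms by (auto simp: subset_chain_def intro: finite_subset)
    then show ?thesis
      using that(2,4) card_seteq[of H H'] by auto
  qed
  moreover have "H \<subseteq> E" if "H \<in> C" for H
    using assms(2) that by (auto simp: subset_chain_def)
  ultimately show ?thesis
    unfolding gap_bottom_def gap_top_def by (intro Union_least Int_greatest Inter_greatest) auto
qed

lemma compatible_extension_gap:
  assumes fin: "finite (ground M)" and C: "C \<subseteq> Pow (ground M)" and S: "S \<in> compatible_extensions M C m"
  shows "union_below C S = gap_bottom C m" "inter_above (ground M) C S = gap_top (ground M) C m"
proof -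
  have "S \<subseteq> ground M"
    using S by (simp add: compatible_extensions_def proper_flats_def flat_def)
  then have finite_below: "finite (union_below C S)"
    using fin by (auto simp: union_below_def intro: finite_subset)
  have below: "card H < m" if "H \<in> C" "H \<subset> S" for H
  proof -
    have "H \<subseteq> union_below C S"
      using that by (auto simp: union_below_def)
    then have "card H \<le> card (union_below C S)"
      using finite_below by (rule card_mono[rotated])
    then show ?thesis
      using S by (simp add: compatible_extensions_def)
  qed
  have above: "m < card H" if "H \<in> C" "S \<subset> H" for H
  proof -
    have "inter_above (ground M) C S \<subseteq> H"
      using that by (auto simp: inter_above_def)
    moreover have "finite H"
      using that(1) C fin by (auto intro: finite_subset)
    ultimately have "card (inter_above (ground M) C S) \<le> card H"
      by (simp add: card_mono)
    then show ?thesis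
      using S by (simp add: compatible_extensions_def)
  qed
  have "(H \<subset> S \<longleftrightarrow> card H \<le> m) \<and> (S \<subset> H \<longleftrightarrow> m \<le> card H)" if "H \<in> C" for H
    using S that below[OF that] above[OF that] by (fastforce simp: compatible_extensions_def)
  then have "{H \<in> C. H \<subset> S} = {H \<in> C. card H \<le> m}" "{H \<in> C. S \<subset> H} = {H \<in> C. m \<le> card H}"
    by blast+
  then show "union_below C S = gap_bottom C m" "inter_above (ground M) C S = gap_top (ground M) C m"
    by (simp_all add: union_below_def inter_above_def gap_bottom_def gap_top_def)
qed

lemma compatible_extension_in_gap:
  assumes "finite (ground M)" "C \<subseteq> Pow (ground M)" "S \<in> compatible_extensions M C m"
  shows "gap_bottom C m \<subseteq> S" "S \<subseteq> gap_top (ground M) C m"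
proof -
  have "S \<subseteq> ground M"
    using assms(3) by (simp add: compatible_extensions_def proper_flats_def flat_def)
  then show "gap_bottom C m \<subseteq> S" "S \<subseteq> gap_top (ground M) C m"
    unfolding compatible_extension_gap[OF assms, symmetric]
    by (auto simp: union_below_def inter_above_def)
qed

lemma compatible_extensionI:
  assumes fin: "finite C" and chain: "subset.chain (Pow (ground M)) C"
    and m: "0 < m" "m < card (ground M)" and S: "S \<in> proper_flats M"
    and comparable: "\<And>H. H \<in> C \<Longrightarrow> S \<subseteq> H \<or> H \<subseteq> S"
    and gap: "\<not> S \<subseteq> gap_bottom C m" "\<not> gap_top (ground M) C m \<subseteq> S"
  shows "S \<in> compatible_extensions M C m"
proof -
  have below: "H \<subset> S" if "H \<in> C" "card H \<le> m" for H
    using comparable[OF that(1)] gap(1) that by (auto simp: gap_bottom_def)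
  have above: "S \<subset> H" if "H \<in> C" "m \<le> card H" for H
    using comparable[OF that(1)] gap(2) that by (auto simp: gap_top_def)
  have "(H \<subset> S \<longleftrightarrow> card H \<le> m) \<and> (S \<subset> H \<longleftrightarrow> m \<le> card H) \<and> card H \<noteq> m" if "H \<in> C" for H
    using below[OF that] above[OF that] by (cases "card H" m rule: linorder_cases) auto
  then have sets: "{H \<in> C. H \<subset> S} = {H \<in> C. card H \<le> m}" "{H \<in> C. S \<subset> H} = {H \<in> C. m \<le> card H}"
    and card_ne: "\<And>H. H \<in> C \<Longrightarrow> card H \<noteq> m"
    by blast+
  have "card (gap_bottom C m) < m" "m < card (gap_top (ground M) C m)"
    using gap_bottom_cases[OF fin chain, of m] gap_top_cases[OF fin chain, of m] m
      card_ne[of "gap_bottom C m"] card_ne[of "gap_top (ground M) C m"]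
    by (auto simp: le_less)
  moreover have "H \<subset> S \<or> S \<subset> H" if "H \<in> C" for H
    using below[OF that] above[OF that] by linarith
  ultimately show ?thesis
    using S sets
    by (simp add: compatible_extensions_def union_below_def inter_above_def gap_bottom_def gap_top_def)
qed

definition extension_weight ::
  "'a set \<Rightarrow> ('a set \<Rightarrow> 'a set \<Rightarrow> nat \<Rightarrow> real) \<Rightarrow> 'a set set \<Rightarrow> 'a set \<Rightarrow> nat \<Rightarrow> real" where
  "extension_weight E \<kappa> C S m =
     (let A = union_below C S; B = inter_above E C S in \<kappa> (B - A) (S - A) (m - card A))"

lemma extension_weight_realized:
  assumes \<kappa>: "deficit_coefficient \<kappa>" and fin: "finite (ground M)"
    and C: "subset.chain (proper_flats M) C" and m: "0 < m" "m < card (ground M)"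
  obtains w where "sum w (ground M) = real m"
    "\<And>S. S \<in> compatible_extensions M C m \<Longrightarrow> deficit w m S = extension_weight (ground M) \<kappa> C S m"
    "\<And>S. S \<in> proper_flats M - compatible_extensions M C m \<Longrightarrow>
      (\<And>H. H \<in> C \<Longrightarrow> S \<subseteq> H \<or> H \<subseteq> S) \<Longrightarrow> deficit w m S = 0"
proof -
  let ?A = "gap_bottom C m" and ?B = "gap_top (ground M) C m"
  have chain: "subset.chain (Pow (ground M)) C"
    using C by (auto simp: subset_chain_def proper_flats_def flat_def)
  then have CE: "C \<subseteq> Pow (ground M)"
    by (simp add: subset_chain_def)
  then have finC: "finite C"
    using fin by (auto intro: finite_subset)
  have gap: "?A \<subseteq> ?B" "?B \<subseteq> ground M" "card ?A \<le> m" "m \<le> card ?B"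
    using gap_bottom_subset_gap_top[OF fin chain, of m] gap_bottom_cases[OF finC chain, of m]
      gap_top_cases[OF finC chain, of m] m(2) by (auto simp: gap_top_def)
  obtain w where w: "sum w (ground M) = real m"
    "\<forall>S. S \<subseteq> ?A \<or> ?B \<subseteq> S \<and> S \<subseteq> ground M \<longrightarrow> deficit w m S = 0"
    "\<forall>S. ?A \<subseteq> S \<and> S \<subseteq> ?B \<longrightarrow> deficit w m S = \<kappa> (?B - ?A) (S - ?A) (m - card ?A)"
    using gap_weight_exists[OF \<kappa> fin gap] by (elim exE conjE)
  show thesis
  proof (rule that[OF w(1)])
    fix S assume "S \<in> compatible_extensions M C m"
    then show "deficit w m S = extension_weight (ground M) \<kappa> C S m"
      using compatible_extension_gap[OF fin CE] compatible_extension_in_gap[OF fin CE] w(3)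
      by (simp add: extension_weight_def Let_def)
  next
    fix S assume S: "S \<in> proper_flats M - compatible_extensions M C m"
      and "\<And>H. H \<in> C \<Longrightarrow> S \<subseteq> H \<or> H \<subseteq> S"
    then have "S \<subseteq> ?A \<or> ?B \<subseteq> S"
      using compatible_extensionI[OF finC chain m] by blast
    then show "deficit w m S = 0"
      using w(2) S by (auto simp: proper_flats_def flat_def)
  qed
qed

section \<open>Extending sequences of flats\<close>

definition sequence_weight ::
  "'a set \<Rightarrow> ('a set \<Rightarrow> 'a set \<Rightarrow> nat \<Rightarrow> real) \<Rightarrow> nat \<Rightarrow> (nat \<Rightarrow> nat) \<Rightarrow> (nat \<Rightarrow> 'a set) \<Rightarrow> real" where
  "sequence_weight E \<kappa> k v G = (\<Prod>i\<in>{1..k}. extension_weight E \<kappa> (G ` {1..<i}) (G i) (v i))"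

lemma fun_upd_Suc_image: "i \<le> Suc k \<Longrightarrow> (G(Suc k := S)) ` {1..<i} = G ` {1..<i}"
  by auto

lemma sequence_weight_Suc:
  "sequence_weight E \<kappa> (Suc k) v (G(Suc k := S)) =
     sequence_weight E \<kappa> k v G * extension_weight E \<kappa> (G ` {1..k}) S (v (Suc k))"
proof -
  have "extension_weight E \<kappa> ((G(Suc k := S)) ` {1..<i}) ((G(Suc k := S)) i) (v i) =
      extension_weight E \<kappa> (G ` {1..<i}) (G i) (v i)" if "i \<in> {1..k}" for i
    using that by (subst fun_upd_Suc_image) auto
  moreover have "(G(Suc k := S)) ` {1..<Suc k} = G ` {1..k}"
    unfolding fun_upd_Suc_image[OF order_refl] by (simp add: atLeastLessThanSuc_atLeastAtMost)
  ultimately show ?thesis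
    unfolding sequence_weight_def by (subst prod.nat_ivl_Suc') (simp_all add: mult.commute)
qed

lemma compatible_seqs_Suc_iff:
  assumes "G \<in> extensional {1..k}"
  shows "G(Suc k := S) \<in> compatible_seqs M (Suc k) v \<longleftrightarrow>
    G \<in> compatible_seqs M k v \<and> S \<in> compatible_extensions M (G ` {1..k}) (v (Suc k))"
proof -
  have "(G(Suc k := S)) i \<in> compatible_extensions M ((G(Suc k := S)) ` {1..<i}) (v i) \<longleftrightarrow>
      G i \<in> compatible_extensions M (G ` {1..<i}) (v i)" if "i \<in> {1..k}" for i
    using that by (subst fun_upd_Suc_image) auto
  moreover have "(G(Suc k := S)) ` {1..<Suc k} = G ` {1..k}"
    unfolding fun_upd_Suc_image[OF order_refl] by (simp add: atLeastLessThanSuc_atLeastAtMost)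
  moreover have "G(Suc k := S) \<in> extensional {1..Suc k}"
    using assms by (auto simp: extensional_def)
  ultimately show ?thesis
    using assms by (simp add: compatible_seqs_def atLeastAtMostSuc_conv conj_commute)
qed

lemma bij_betw_compatible_seqs_Suc:
  "bij_betw (\<lambda>(G, S). G(Suc k := S))
     (SIGMA G:compatible_seqs M k v. compatible_extensions M (G ` {1..k}) (v (Suc k)))
     (compatible_seqs M (Suc k) v)"
proof (rule bij_betw_byWitness[where f' = "\<lambda>G. (restrict G {1..k}, G (Suc k))"])
  have ext: "G \<in> extensional {1..k}" if "G \<in> compatible_seqs M k v" for G k
    using that by (simp add: compatible_seqs_def)
  have upd: "(restrict G {1..k})(Suc k := G (Suc k)) = G" if "G \<in> extensional {1..Suc k}" for G
    using extensional_restrict[OF that] by (simp add: atLeastAtMostSuc_conv)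
  show "\<forall>x\<in>SIGMA G:compatible_seqs M k v. compatible_extensions M (G ` {1..k}) (v (Suc k)).
      (\<lambda>G. (restrict G {1..k}, G (Suc k))) ((\<lambda>(G, S). G(Suc k := S)) x) = x"
    using ext by (auto simp: extensional_restrict)
  show "\<forall>G\<in>compatible_seqs M (Suc k) v.
      (\<lambda>(G, S). G(Suc k := S)) (restrict G {1..k}, G (Suc k)) = G"
    using ext upd by auto
  show "(\<lambda>(G, S). G(Suc k := S)) `
      (SIGMA G:compatible_seqs M k v. compatible_extensions M (G ` {1..k}) (v (Suc k)))
      \<subseteq> compatible_seqs M (Suc k) v"
    using ext by (auto simp: compatible_seqs_Suc_iff simp del: fun_upd_apply)
  show "(\<lambda>G. (restrict G {1..k}, G (Suc k))) ` compatible_seqs M (Suc k) v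
      \<subseteq> (SIGMA G:compatible_seqs M k v. compatible_extensions M (G ` {1..k}) (v (Suc k)))"
  proof (rule image_subsetI)
    fix G assume "G \<in> compatible_seqs M (Suc k) v"
    then have "(restrict G {1..k})(Suc k := G (Suc k)) \<in> compatible_seqs M (Suc k) v"
      by (simp only: upd ext)
    then show "(restrict G {1..k}, G (Suc k)) \<in>
        (SIGMA G:compatible_seqs M k v. compatible_extensions M (G ` {1..k}) (v (Suc k)))"
      by (subst (asm) compatible_seqs_Suc_iff) auto
  qed
qed

lemma compatible_seqs_proper: "G \<in> compatible_seqs M k v \<Longrightarrow> G ` {1..k} \<subseteq> proper_flats M"
  by (auto simp: compatible_seqs_def compatible_extensions_def)

lemma compatible_seqs_chain:
  assumes "G \<in> compatible_seqs M k v"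
  shows "subset.chain (proper_flats M) (G ` {1..k})"
proof -
  have "G i \<subseteq> G j \<or> G j \<subseteq> G i" if "i \<in> {1..k}" "j \<in> {1..k}" for i j
    using compatible_seqs_comparable[OF assms, of i j] compatible_seqs_comparable[OF assms, of j i] that
    by (cases i j rule: linorder_cases) auto
  then show ?thesis
    using compatible_seqs_proper[OF assms] unfolding subset_chain_def by blast
qed

lemma finite_proper_flats: "finite (ground M) \<Longrightarrow> finite (proper_flats M)"
  by (rule finite_subset[of _ "Pow (ground M)"]) (auto simp: proper_flats_def flat_def)

lemma finite_compatible_seqs:
  assumes "finite (ground M)"
  shows "finite (compatible_seqs M k v)"
proof (rule finite_subset)
  show "compatible_seqs M k v \<subseteq> {1..k} \<rightarrow>\<^sub>E proper_flats M"
    by (rule compatible_seqs_subset_PiE)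
  show "finite ({1..k} \<rightarrow>\<^sub>E proper_flats M)"
    using assms by (intro finite_PiE finite_proper_flats) auto
qed

lemma sum_compatible_seqs_Suc:
  assumes "finite (ground M)"
  shows "(\<Sum>G\<in>compatible_seqs M (Suc k) v. f G) =
    (\<Sum>G\<in>compatible_seqs M k v. \<Sum>S\<in>compatible_extensions M (G ` {1..k}) (v (Suc k)). f (G(Suc k := S)))"
proof -
  have "finite (compatible_extensions M C m)" for C m
    using finite_proper_flats[OF assms] by (simp add: compatible_extensions_def)
  then show ?thesis
    using assms
    by (simp add: sum.reindex_bij_betw[OF bij_betw_compatible_seqs_Suc, symmetric] sum.Sigma
        finite_compatible_seqs case_prod_unfold)
qed

section \<open>Tree weights\<close>

definition tree_weight :: "('a set \<Rightarrow> 'a set \<Rightarrow> nat \<Rightarrow> real) \<Rightarrow> 'a set_system \<Rightarrow> (nat \<Rightarrow> nat) \<Rightarrow>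
    vertex set \<Rightarrow> (vertex \<Rightarrow> nat) \<Rightarrow> (vertex \<Rightarrow> 'a set) \<Rightarrow> real" where
  "tree_weight \<kappa> M v T \<sigma> F =
     (\<Prod>b\<in>T.
        let A = flat_left T \<sigma> F b; B = flat_right M T \<sigma> F b
        in \<kappa> (B - A) (F b - A) (v (\<sigma> b) - card A))"

lemma (in flat_filled_tree) tree_weight_eq_sequence_weight:
  "tree_weight \<kappa> M v T \<sigma> F = sequence_weight (ground M) \<kappa> k v flats"
  unfolding tree_weight_def sequence_weight_def
  by (subst prod.reindex_bij_betw[OF bij_vert, symmetric])
    (simp add: flat_left_vert flat_right_vert flats_eq extension_weight_def)

lemma (in flat_filled_tree) flat_left_subset_flat_right:
  assumes "b \<in> T"
  shows "flat_left T \<sigma> F b \<subseteq> flat_right M T \<sigma> F b" and "flat_right M T \<sigma> F b \<subseteq> ground M"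
proof -
  obtain i where i: "i \<in> {1..k}" "b = vert i"
    using assms vert_image by blast
  have "flats i \<subseteq> ground M"
    using flats_proper[OF i(1)] by (simp add: proper_flats_def flat_def)
  then show "flat_left T \<sigma> F b \<subseteq> flat_right M T \<sigma> F b" "flat_right M T \<sigma> F b \<subseteq> ground M"
    unfolding i(2) flat_left_vert[OF i(1)] flat_right_vert[OF i(1)]
    by (auto simp: union_below_def inter_above_def)
qed

lemma wt_mult_eq_tree_weight:
  assumes "(T, \<sigma>, F) \<in> compatible_trees M k v"
  shows "wt_mult M v T \<sigma> F = tree_weight (\<lambda>D X j. mlt D (card X) (int j)) M v T \<sigma> F"
  using assms unfolding wt_mult_def tree_weight_def
  by (intro prod.cong) (auto simp: compatible_trees_iff compatible_def Let_def of_nat_diff less_imp_le)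

lemma wt_OI_eq_tree_weight:
  assumes "finite (ground M)" and t: "(T, \<sigma>, F) \<in> compatible_trees M k v"
  shows "wt_OI M v T \<sigma> F =
    tree_weight (\<lambda>D X j. real_of_int (OI D X (largest (card D - j) D))) M v T \<sigma> F"
proof -
  interpret flat_filled_tree M k T \<sigma> F
    using t by (simp add: compatible_trees_iff)
  have "card (flat_right M T \<sigma> F b - flat_left T \<sigma> F b) - (v (\<sigma> b) - card (flat_left T \<sigma> F b)) =
      card (flat_right M T \<sigma> F b) - v (\<sigma> b)" if "b \<in> T" for b
  proof -
    have "finite (flat_left T \<sigma> F b)" "card (flat_left T \<sigma> F b) \<le> v (\<sigma> b)"
      using flat_left_subset_flat_right[OF that] assms(1) t that
      by (auto simp: compatible_trees_iff compatible_def less_imp_le intro: finite_subset)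
    then show ?thesis
      using flat_left_subset_flat_right(1)[OF that] by (simp add: card_Diff_subset)
  qed
  then show ?thesis
    unfolding wt_OI_def tree_weight_def by (intro prod.cong) (simp_all add: Let_def)
qed

section \<open>Polynomials\<close>

lemma carrier_polynomial_ring:
  "p \<in> carrier (polynomial_ring I) \<longleftrightarrow> (\<forall>m\<in>Poly_Mapping.keys p. Poly_Mapping.keys m \<subseteq> I)"
  by (simp add: polynomial_ring_def)

lemma polynomial_ring_simps [simp]:
  "x \<oplus>\<^bsub>polynomial_ring I\<^esub> y = x + y" "x \<otimes>\<^bsub>polynomial_ring I\<^esub> y = x * y"
  "\<zero>\<^bsub>polynomial_ring I\<^esub> = 0" "\<one>\<^bsub>polynomial_ring I\<^esub> = 1"
  by (simp_all add: polynomial_ring_def)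

lemma poly_zero_closed [simp]: "0 \<in> carrier (polynomial_ring I)"
  by (simp add: carrier_polynomial_ring)

lemma poly_one_closed [simp]: "1 \<in> carrier (polynomial_ring I)"
  by (simp add: carrier_polynomial_ring)

lemma poly_add_closed [simp]:
  "p \<in> carrier (polynomial_ring I) \<Longrightarrow> q \<in> carrier (polynomial_ring I) \<Longrightarrow>
    p + q \<in> carrier (polynomial_ring I)"
  using Poly_Mapping.keys_add[of p q] by (fastforce simp: carrier_polynomial_ring)

lemma poly_uminus_closed [simp]:
  "p \<in> carrier (polynomial_ring I) \<Longrightarrow> - p \<in> carrier (polynomial_ring I)"
  by (simp add: carrier_polynomial_ring)

lemma poly_diff_closed [simp]:
  "p \<in> carrier (polynomial_ring I) \<Longrightarrow> q \<in> carrier (polynomial_ring I) \<Longrightarrow>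
    p - q \<in> carrier (polynomial_ring I)"
  using poly_add_closed[of p I "- q"] by simp

lemma poly_mult_closed [simp]:
  assumes "p \<in> carrier (polynomial_ring I)" "q \<in> carrier (polynomial_ring I)"
  shows "p * q \<in> carrier (polynomial_ring I)"
  unfolding carrier_polynomial_ring
proof
  fix m assume "m \<in> Poly_Mapping.keys (p * q)"
  then obtain a b where "m = a + b" "a \<in> Poly_Mapping.keys p" "b \<in> Poly_Mapping.keys q"
    using keys_mult[of p q] by blast
  then show "Poly_Mapping.keys m \<subseteq> I"
    using assms Poly_Mapping.keys_add[of a b] unfolding carrier_polynomial_ring by blast
qed

lemma poly_sum_closed [simp]:
  "(\<And>a. a \<in> A \<Longrightarrow> f a \<in> carrier (polynomial_ring I)) \<Longrightarrow> sum f A \<in> carrier (polynomial_ring I)"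
  by (induction A rule: infinite_finite_induct) auto

lemma poly_prod_closed [simp]:
  "(\<And>a. a \<in> A \<Longrightarrow> f a \<in> carrier (polynomial_ring I)) \<Longrightarrow> prod f A \<in> carrier (polynomial_ring I)"
  by (induction A rule: infinite_finite_induct) auto

lemma Const_closed [simp]: "Const c \<in> carrier (polynomial_ring I)"
  by (simp add: carrier_polynomial_ring Const_def)

lemma Var_closed [simp]: "i \<in> I \<Longrightarrow> Var i \<in> carrier (polynomial_ring I)"
  by (simp add: carrier_polynomial_ring Var_def)

lemma Const_0 [simp]: "Const 0 = 0"
  by (simp add: Const_def)

lemma Const_1 [simp]: "Const 1 = 1"
  by (simp add: Const_def)

lemma Const_add: "Const (a + b) = Const a + Const b"
  by (simp add: Const_def single_add)

lemma Const_mult: "Const (a * b) = Const a * Const b"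
  by (simp add: Const_def mult_single)

lemma Const_sum: "Const (sum f A) = (\<Sum>a\<in>A. Const (f a))"
  by (induction A rule: infinite_finite_induct) (simp_all add: Const_add)

lemma cring_polynomial_ring: "cring (polynomial_ring I)"
proof (rule cringI)
  show "abelian_group (polynomial_ring I)"
  proof (rule abelian_groupI)
    fix p assume "p \<in> carrier (polynomial_ring I)"
    then show "\<exists>q\<in>carrier (polynomial_ring I). q \<oplus>\<^bsub>polynomial_ring I\<^esub> p = \<zero>\<^bsub>polynomial_ring I\<^esub>"
      by (intro bexI[of _ "- p"]) simp_all
  qed (simp_all add: ac_simps)
  show "comm_monoid (polynomial_ring I)"
    by unfold_locales (simp_all add: ac_simps)
qed (simp add: distrib_right)

section \<open>The Chow ring\<close>

definition chain_monomial :: "'a set set \<Rightarrow> 'a set mpoly" where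
  "chain_monomial C = (\<Prod>G\<in>C. Var G)"

definition gamma_poly :: "'a set_system \<Rightarrow> nat \<Rightarrow> 'a set mpoly" where
  "gamma_poly M m =
     (if 1 \<le> m \<and> m < card (ground M)
      then \<Sum>S\<in>proper_flats M. Const (mlt (ground M) (card S) (int m)) * Var S else 0)"

lemma chain_monomial_insert_extension:
  assumes "S \<in> compatible_extensions M (G ` {1..k}) m"
  shows "chain_monomial ((G(Suc k := S)) ` {1..Suc k}) = Var S * chain_monomial (G ` {1..k})"
proof -
  have "S \<notin> G ` {1..k}"
    using assms by (auto simp: compatible_extensions_def)
  moreover have "(G(Suc k := S)) ` {1..Suc k} = insert S (G ` {1..k})"
    by (auto simp: image_iff le_Suc_eq)
  ultimately show ?thesis
    by (simp add: chain_monomial_def)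
qed

locale chow =
  fixes M :: "'a set_system"
  assumes finite_ground: "finite (ground M)"
begin

abbreviation "E \<equiv> ground M"
abbreviation "P \<equiv> proper_flats M"
abbreviation "R \<equiv> polynomial_ring P"
abbreviation "A \<equiv> chow_ring M"
abbreviation "cl \<equiv> chow_class M"

lemma proper_flat_subset: "S \<in> P \<Longrightarrow> S \<subseteq> E"
  by (simp add: proper_flats_def flat_def)

lemma finite_P: "finite P"
  using finite_ground by (rule finite_proper_flats)

lemma chow_relations_closed: "chow_relations M \<subseteq> carrier R"
  by (auto simp: chow_relations_def intro!: poly_mult_closed poly_diff_closed poly_sum_closed Var_closed)

lemma ideal_chow_ideal: "ideal (chow_ideal M) R"
  unfolding chow_ideal_def
  by (rule ring.genideal_ideal[OF cring.axioms(1)[OF cring_polynomial_ring] chow_relations_closed])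

lemma cring_chow_ring: "cring A"
  unfolding chow_ring_def
  by (rule ideal.quotient_is_cring[OF ideal_chow_ideal cring_polynomial_ring])

sublocale cring A
  by (rule cring_chow_ring)

lemma ring_hom_cring_cl: "ring_hom_cring R A cl"
proof -
  have "cl = (+>\<^bsub>R\<^esub>) (chow_ideal M)"
    by (simp add: chow_class_def fun_eq_iff)
  then show ?thesis
    unfolding chow_ring_def
    using ideal.rcos_ring_hom_cring[OF ideal_chow_ideal cring_polynomial_ring] by simp
qed

lemma cl_in_ring_hom: "cl \<in> ring_hom R A"
  using ring_hom_cring_cl by (simp add: ring_hom_cring_def ring_hom_cring_axioms_def)

lemma cl_closed [simp]: "p \<in> carrier R \<Longrightarrow> cl p \<in> carrier A"
  by (rule ring_hom_closed[OF cl_in_ring_hom])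

lemma cl_add: "p \<in> carrier R \<Longrightarrow> q \<in> carrier R \<Longrightarrow> cl (p + q) = cl p \<oplus>\<^bsub>A\<^esub> cl q"
  using ring_hom_add[OF cl_in_ring_hom, of p q] by simp

lemma cl_mult: "p \<in> carrier R \<Longrightarrow> q \<in> carrier R \<Longrightarrow> cl (p * q) = cl p \<otimes>\<^bsub>A\<^esub> cl q"
  using ring_hom_mult[OF cl_in_ring_hom, of p q] by simp

lemma cl_0: "cl 0 = \<zero>\<^bsub>A\<^esub>"
  using ring_hom_cring.hom_zero[OF ring_hom_cring_cl] by simp

lemma cl_1: "cl 1 = \<one>\<^bsub>A\<^esub>"
  using ring_hom_one[OF cl_in_ring_hom] by simp

lemma cl_sum: "(\<And>a. a \<in> I \<Longrightarrow> f a \<in> carrier R) \<Longrightarrow> cl (sum f I) = (\<Oplus>\<^bsub>A\<^esub>a\<in>I. cl (f a))"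
  by (induction I rule: infinite_finite_induct) (simp_all add: cl_0 cl_add Pi_def)

lemma cl_prod: "(\<And>a. a \<in> I \<Longrightarrow> f a \<in> carrier R) \<Longrightarrow> cl (prod f I) = (\<Otimes>\<^bsub>A\<^esub>a\<in>I. cl (f a))"
  by (induction I rule: infinite_finite_induct) (simp_all add: cl_1 cl_mult Pi_def)

lemma cl_sum_mono_neutral:
  assumes "finite I" "J \<subseteq> I" "\<And>a. a \<in> I \<Longrightarrow> f a \<in> carrier R"
    "\<And>a. a \<in> I - J \<Longrightarrow> cl (f a) = \<zero>\<^bsub>A\<^esub>"
  shows "cl (sum f I) = cl (sum f J)"
proof -
  have "(\<Oplus>\<^bsub>A\<^esub>a\<in>I. cl (f a)) = (\<Oplus>\<^bsub>A\<^esub>a\<in>J. cl (f a))"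
    using assms by (intro add.finprod_mono_neutral_cong_right) auto
  then show ?thesis
    using assms(2,3) by (simp add: cl_sum subset_iff)
qed

lemma cl_sum_cong:
  assumes "\<And>a. a \<in> I \<Longrightarrow> f a \<in> carrier R" "\<And>a. a \<in> I \<Longrightarrow> g a \<in> carrier R"
    "\<And>a. a \<in> I \<Longrightarrow> cl (f a) = cl (g a)"
  shows "cl (sum f I) = cl (sum g I)"
  using assms by (simp add: cl_sum) (intro finsum_cong', auto)

lemma cl_mult_cong:
  assumes "p \<in> carrier R" "q \<in> carrier R" "cl p = cl q" "r \<in> carrier R"
  shows "cl (r * p) = cl (r * q)"
  using assms by (simp add: cl_mult)

lemma cl_in_ideal:
  assumes "p \<in> chow_ideal M"
  shows "cl p = \<zero>\<^bsub>A\<^esub>"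
proof -
  interpret ideal "chow_ideal M" R by (rule ideal_chow_ideal)
  show ?thesis
    using a_rcos_const[OF assms] by (simp add: chow_class_def chow_ring_def FactRing_def)
qed

lemma chow_relations_in_ideal: "chow_relations M \<subseteq> chow_ideal M"
  unfolding chow_ideal_def
  by (rule ring.genideal_self[OF cring.axioms(1)[OF cring_polynomial_ring] chow_relations_closed])

lemma cl_Var_mult_incomparable:
  assumes "S \<in> P" "H \<in> P" "\<not> S \<subseteq> H" "\<not> H \<subseteq> S"
  shows "cl (Var S * Var H) = \<zero>\<^bsub>A\<^esub>"
proof -
  have "Var S * Var H \<in> chow_relations M"
    using assms by (auto simp: chow_relations_def)
  then show ?thesis
    using chow_relations_in_ideal cl_in_ideal by blast
qed

definition alpha :: "'a \<Rightarrow> 'a set mpoly" where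
  "alpha i = (\<Sum>G\<in>{G \<in> P. i \<in> G}. Var G)"

lemma alpha_closed [simp]: "alpha i \<in> carrier R"
  by (auto simp: alpha_def intro!: poly_sum_closed)

lemma cl_alpha_eq:
  assumes "i \<in> E" "j \<in> E"
  shows "cl (alpha i) = cl (alpha j)"
proof -
  have "alpha i - alpha j \<in> chow_relations M"
    using assms by (auto simp: chow_relations_def alpha_def)
  then have "cl (alpha i - alpha j) = \<zero>\<^bsub>A\<^esub>"
    using chow_relations_in_ideal cl_in_ideal by blast
  then show ?thesis
    using cl_add[of "alpha i - alpha j" "alpha j"] by simp
qed

text \<open>Hence only the total mass of a weight on the ground set matters.\<close>

lemma cl_massless_weight:
  fixes c :: "'a \<Rightarrow> real"
  assumes "sum c E = 0"
  shows "cl (\<Sum>S\<in>P. Const (sum c S) * Var S) = \<zero>\<^bsub>A\<^esub>"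
proof (cases "E = {}")
  case True
  then have "P = {}"
    using proper_flat_subset by (auto simp: proper_flats_def)
  then show ?thesis
    by (simp add: cl_0)
next
  case False
  then obtain j where j: "j \<in> E" by blast
  have "(\<Sum>S\<in>P. Const (sum c S) * Var S) = (\<Sum>S\<in>P. \<Sum>e\<in>{e. e \<in> E \<and> e \<in> S}. Const (c e) * Var S)"
  proof (rule sum.cong)
    fix S assume "S \<in> P"
    then have "{e. e \<in> E \<and> e \<in> S} = S"
      using proper_flat_subset by blast
    then show "Const (sum c S) * Var S = (\<Sum>e\<in>{e. e \<in> E \<and> e \<in> S}. Const (c e) * Var S)"
      by (simp add: Const_sum sum_distrib_right)
  qed simp
  also have "\<dots> = (\<Sum>e\<in>E. \<Sum>S\<in>{S. S \<in> P \<and> e \<in> S}. Const (c e) * Var S)"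
    using finite_P finite_ground by (rule sum.swap_restrict)
  also have "\<dots> = (\<Sum>e\<in>E. Const (c e) * alpha e)"
    by (simp add: alpha_def sum_distrib_left)
  also have "cl \<dots> = cl (\<Sum>e\<in>E. Const (c e) * alpha j)"
    by (intro cl_sum_cong cl_mult_cong cl_alpha_eq j) simp_all
  also have "(\<Sum>e\<in>E. Const (c e) * alpha j) = Const (sum c E) * alpha j"
    by (simp add: Const_sum sum_distrib_right)
  finally show ?thesis
    using assms by (simp add: cl_0)
qed

lemma gamma_poly_closed [simp]: "gamma_poly M m \<in> carrier R"
  by (simp add: gamma_poly_def)

lemma chain_monomial_closed [simp]: "C \<subseteq> P \<Longrightarrow> chain_monomial C \<in> carrier R"
  by (auto simp: chain_monomial_def intro!: poly_prod_closed)

lemma cl_gamma_poly_deficit: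
  assumes m: "1 \<le> m" "m < card E" and w: "sum w E = real m"
  shows "cl (gamma_poly M m) = cl (\<Sum>S\<in>P. Const (deficit w m S) * Var S)"
proof -
  define c where "c e = w e - real m / real (card E)" for e
  have "sum c E = 0"
    using m w by (simp add: c_def sum_subtractf)
  have "mlt E (card S) (int m) = deficit w m S + sum c S" for S
    by (auto simp: mlt_def deficit_def c_def sum_subtractf min_def)
  then have "gamma_poly M m =
      (\<Sum>S\<in>P. Const (deficit w m S) * Var S) + (\<Sum>S\<in>P. Const (sum c S) * Var S)"
    using m by (simp add: gamma_poly_def Const_add distrib_right sum.distrib)
  then show ?thesis
    using cl_massless_weight[OF \<open>sum c E = 0\<close>] by (simp add: cl_add)
qed

lemma cl_Var_mult_chain_monomial_incomparable:
  assumes "C \<subseteq> P" "S \<in> P" "H \<in> C" "\<not> S \<subseteq> H" "\<not> H \<subseteq> S"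
  shows "cl (Var S * chain_monomial C) = \<zero>\<^bsub>A\<^esub>"
proof -
  have closed: "H \<in> P" "chain_monomial (C - {H}) \<in> carrier R"
    using assms(1,3) by (auto intro!: chain_monomial_closed)
  have "finite C"
    using assms(1) finite_P by (rule finite_subset)
  then have "chain_monomial C = Var H * chain_monomial (C - {H})"
    unfolding chain_monomial_def using assms(3) by (rule prod.remove)
  then have "cl (Var S * chain_monomial C) = cl (Var S * Var H * chain_monomial (C - {H}))"
    by (simp add: mult.assoc)
  also have "\<dots> = cl (Var S * Var H) \<otimes>\<^bsub>A\<^esub> cl (chain_monomial (C - {H}))"
    using assms(2) closed by (intro cl_mult) simp_all
  also have "\<dots> = \<zero>\<^bsub>A\<^esub>"
    using assms closed by (simp add: cl_Var_mult_incomparable)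
  finally show ?thesis .
qed

lemma cl_chain_sum_restrict:
  assumes C: "C \<subseteq> P" and Q: "Q \<subseteq> P"
    and vanishing: "\<And>S. S \<in> P - Q \<Longrightarrow> (\<And>H. H \<in> C \<Longrightarrow> S \<subseteq> H \<or> H \<subseteq> S) \<Longrightarrow> c S = 0"
  shows "cl (\<Sum>S\<in>P. Const (c S) * (Var S * chain_monomial C)) =
    cl (\<Sum>S\<in>Q. Const (c S) * (Var S * chain_monomial C))"
proof (rule cl_sum_mono_neutral[OF finite_P Q])
  show "Const (c S) * (Var S * chain_monomial C) \<in> carrier R" if "S \<in> P" for S
    using that C by simp
  show "cl (Const (c S) * (Var S * chain_monomial C)) = \<zero>\<^bsub>A\<^esub>" if S: "S \<in> P - Q" for S
  proof (cases "\<exists>H\<in>C. \<not> S \<subseteq> H \<and> \<not> H \<subseteq> S")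
    case True
    then have "cl (Var S * chain_monomial C) = \<zero>\<^bsub>A\<^esub>"
      using cl_Var_mult_chain_monomial_incomparable[OF C] S by blast
    then show ?thesis
      using S C by (subst cl_mult) simp_all
  next
    case False
    then have "c S = 0"
      using vanishing[OF S] by blast
    then show ?thesis
      by (simp add: cl_0)
  qed
qed

lemma cl_chain_monomial_mult_gamma_poly:
  assumes \<kappa>: "deficit_coefficient \<kappa>" and C: "subset.chain P C" and m: "1 \<le> m"
  shows "cl (chain_monomial C * gamma_poly M m) =
    cl (\<Sum>S\<in>compatible_extensions M C m.
          Const (extension_weight E \<kappa> C S m) * (Var S * chain_monomial C))"
proof (cases "m < card E")
  case False
  have "card (inter_above E C S) \<le> card E" for S
    using finite_ground by (intro card_mono) (auto simp: inter_above_def)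
  then have "compatible_extensions M C m = {}"
    using False by (auto simp: compatible_extensions_def not_less dest: order_trans)
  then show ?thesis
    using False by (simp add: gamma_poly_def)
next
  case True
  let ?Q = "compatible_extensions M C m"
  obtain w where w: "sum w E = real m" "\<And>S. S \<in> ?Q \<Longrightarrow> deficit w m S = extension_weight E \<kappa> C S m"
    "\<And>S. S \<in> P - ?Q \<Longrightarrow> (\<And>H. H \<in> C \<Longrightarrow> S \<subseteq> H \<or> H \<subseteq> S) \<Longrightarrow> deficit w m S = 0"
    using extension_weight_realized[OF \<kappa> finite_ground C _ True] m by auto
  let ?term = "\<lambda>S. Const (deficit w m S) * (Var S * chain_monomial C)"
  have CP: "C \<subseteq> P"
    using C by (simp add: subset_chain_def)
  have "cl (chain_monomial C * gamma_poly M m) =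
      cl (chain_monomial C * (\<Sum>S\<in>P. Const (deficit w m S) * Var S))"
    using CP by (intro cl_mult_cong cl_gamma_poly_deficit m True w(1)) simp_all
  also have "chain_monomial C * (\<Sum>S\<in>P. Const (deficit w m S) * Var S) = sum ?term P"
    by (simp add: sum_distrib_left ac_simps)
  also have "cl (sum ?term P) = cl (sum ?term ?Q)"
    using w(3) by (intro cl_chain_sum_restrict CP) (auto simp: compatible_extensions_def)
  also have "sum ?term ?Q =
      (\<Sum>S\<in>?Q. Const (extension_weight E \<kappa> C S m) * (Var S * chain_monomial C))"
    using w(2) by (intro sum.cong) auto
  finally show ?thesis .
qed

lemma cl_prod_gamma_poly:
  assumes \<kappa>: "deficit_coefficient \<kappa>" and v: "\<And>i. i \<in> {1..k} \<Longrightarrow> 0 < v i"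
  shows "cl (\<Prod>i\<in>{1..k}. gamma_poly M (v i)) =
    cl (\<Sum>G\<in>compatible_seqs M k v. Const (sequence_weight E \<kappa> k v G) * chain_monomial (G ` {1..k}))"
  using v
proof (induction k)
  case 0
  have "compatible_seqs M 0 v = {\<lambda>_. undefined}"
    by (auto simp: compatible_seqs_def)
  then show ?case
    by (simp add: sequence_weight_def chain_monomial_def)
next
  case (Suc k)
  let ?c = "sequence_weight E \<kappa> k v" and ?X = "\<lambda>G. chain_monomial (G ` {1..k})"
  let ?ext = "\<lambda>G. compatible_extensions M (G ` {1..k}) (v (Suc k))"
  let ?d = "\<lambda>G S. extension_weight E \<kappa> (G ` {1..k}) S (v (Suc k))"
  let ?term = "\<lambda>G. Const (sequence_weight E \<kappa> (Suc k) v G) * chain_monomial (G ` {1..Suc k})"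
  have X_closed: "?X G \<in> carrier R" if "G \<in> compatible_seqs M k v" for G
    using compatible_seqs_proper[OF that] by simp
  have ext_closed: "(\<Sum>S\<in>?ext G. Const (?d G S) * (Var S * ?X G)) \<in> carrier R"
    if "G \<in> compatible_seqs M k v" for G
    using X_closed[OF that] by (auto simp: compatible_extensions_def intro!: poly_sum_closed)
  have "cl (\<Prod>i\<in>{1..Suc k}. gamma_poly M (v i)) =
      cl (gamma_poly M (v (Suc k)) * (\<Prod>i\<in>{1..k}. gamma_poly M (v i)))"
    by (subst prod.nat_ivl_Suc') simp_all
  also have "\<dots> = cl (gamma_poly M (v (Suc k)) * (\<Sum>G\<in>compatible_seqs M k v. Const (?c G) * ?X G))"
    using Suc X_closed by (intro cl_mult_cong Suc.IH) auto
  also have "gamma_poly M (v (Suc k)) * (\<Sum>G\<in>compatible_seqs M k v. Const (?c G) * ?X G) =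
      (\<Sum>G\<in>compatible_seqs M k v. Const (?c G) * (?X G * gamma_poly M (v (Suc k))))"
    by (simp add: sum_distrib_left ac_simps)
  also have "cl \<dots> = cl (\<Sum>G\<in>compatible_seqs M k v.
      Const (?c G) * (\<Sum>S\<in>?ext G. Const (?d G S) * (Var S * ?X G)))"
    using Suc.prems[of "Suc k"] X_closed ext_closed
    by (intro cl_sum_cong cl_mult_cong cl_chain_monomial_mult_gamma_poly \<kappa> compatible_seqs_chain)
      auto
  also have "(\<Sum>G\<in>compatible_seqs M k v.
      Const (?c G) * (\<Sum>S\<in>?ext G. Const (?d G S) * (Var S * ?X G))) =
      (\<Sum>G\<in>compatible_seqs M k v. \<Sum>S\<in>?ext G. ?term (G(Suc k := S)))"
    unfolding sum_distrib_left
    by (intro sum.cong refl)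
      (simp only: sequence_weight_Suc chain_monomial_insert_extension Const_mult mult.assoc)
  also have "\<dots> = sum ?term (compatible_seqs M (Suc k) v)"
    by (rule sum_compatible_seqs_Suc[OF finite_ground, symmetric])
  finally show ?case .
qed

lemma chow_scale_cl: "p \<in> carrier R \<Longrightarrow> chow_scale M c (cl p) = cl (Const c * p)"
  by (simp add: chow_scale_def cl_mult)

lemma hypersimplex_class_cl: "hypersimplex_class M m = cl (gamma_poly M m)"
proof (cases "1 \<le> m \<and> m < card E")
  case True
  let ?g = "\<lambda>S. chow_scale M (mlt E (card S) (int m)) (chow_x M S)"
  let ?B = "{S. S \<noteq> {} \<and> S \<subset> E}"
  have sub: "P \<subseteq> ?B" by (auto simp: proper_flats_def flat_def)
  have class_flat: "?g S = cl (Const (mlt E (card S) (int m)) * Var S)" if "S \<in> P" for S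
    using that by (simp add: chow_x_def chow_scale_cl)
  have class_not_flat: "?g S = \<zero>\<^bsub>A\<^esub>" if "S \<notin> P" for S
    using that by (simp add: chow_x_def chow_scale_def)
  have class_closed: "?g S \<in> carrier A" for S
    by (cases "S \<in> P") (simp_all add: class_flat class_not_flat)
  have fin: "finite ?B"
    by (rule finite_subset[of _ "Pow E"]) (use finite_ground in auto)
  have "hypersimplex_class M m = finsum A ?g ?B"
    using True by (simp add: hypersimplex_class_def)
  also have "\<dots> = finsum A ?g P"
    using sub fin class_not_flat class_closed by (intro add.finprod_mono_neutral_cong_right) auto
  also have "\<dots> = (\<Oplus>\<^bsub>A\<^esub>S\<in>P. cl (Const (mlt E (card S) (int m)) * Var S))"
    using class_flat by (intro finsum_cong') auto
  also have "\<dots> = cl (gamma_poly M m)"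
    using True by (simp add: gamma_poly_def cl_sum)
  finally show ?thesis .
qed (auto simp: hypersimplex_class_def gamma_poly_def cl_0)

lemma chow_x_chain_cl:
  assumes "F ` T \<subseteq> P"
  shows "chow_x_chain M T F = cl (chain_monomial (F ` T))"
proof -
  have "chow_x_chain M T F = (\<Otimes>\<^bsub>A\<^esub>G\<in>F ` T. cl (Var G))"
    unfolding chow_x_chain_def
    by (rule finprod_cong') (use assms in \<open>auto simp: chow_x_def\<close>)
  also have "\<dots> = cl (chain_monomial (F ` T))"
    unfolding chain_monomial_def using assms by (intro cl_prod[symmetric] Var_closed) blast
  finally show ?thesis .
qed

lemma prod_hypersimplex_class:
  assumes \<kappa>: "deficit_coefficient \<kappa>" and v: "\<And>i. i \<in> {1..k} \<Longrightarrow> 0 < v i"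
    and wt: "\<And>T \<sigma> F. (T, \<sigma>, F) \<in> compatible_trees M k v \<Longrightarrow> wt T \<sigma> F = tree_weight \<kappa> M v T \<sigma> F"
  shows "(\<Otimes>\<^bsub>A\<^esub>i\<in>{1..k}. hypersimplex_class M (v i)) =
    (\<Oplus>\<^bsub>A\<^esub>t\<in>compatible_trees M k v.
       case t of (T, \<sigma>, F) \<Rightarrow> chow_scale M (wt T \<sigma> F) (chow_x_chain M T F))"
proof -
  let ?term = "\<lambda>G. Const (sequence_weight E \<kappa> k v G) * chain_monomial (G ` {1..k})"
  have closed: "?term (flats_by_label k t) \<in> carrier R" if "t \<in> compatible_trees M k v" for t
    using compatible_seqs_proper[OF bij_betw_apply[OF bij_betw_flats_by_label that]] by simp
  have tree_term: "(case t of (T, \<sigma>, F) \<Rightarrow> chow_scale M (wt T \<sigma> F) (chow_x_chain M T F)) =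
      cl (?term (flats_by_label k t))" if t: "t \<in> compatible_trees M k v" for t
  proof -
    obtain T \<sigma> F where t_eq: "t = (T, \<sigma>, F)"
      by (cases t)
    interpret flat_filled_tree M k T \<sigma> F
      using t by (simp add: t_eq compatible_trees_iff)
    have "F ` T \<subseteq> P"
      using filling by (simp add: flat_filling_def)
    then show ?thesis
      using wt[of T \<sigma> F] t unfolding t_eq flats_image
      by (simp add: chow_x_chain_cl chow_scale_cl tree_weight_eq_sequence_weight)
  qed
  have "(\<Otimes>\<^bsub>A\<^esub>i\<in>{1..k}. hypersimplex_class M (v i)) = cl (\<Prod>i\<in>{1..k}. gamma_poly M (v i))"
    by (simp add: hypersimplex_class_cl cl_prod)
  also have "\<dots> = cl (sum ?term (compatible_seqs M k v))"
    using \<kappa> v by (rule cl_prod_gamma_poly)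
  also have "sum ?term (compatible_seqs M k v) = (\<Sum>t\<in>compatible_trees M k v. ?term (flats_by_label k t))"
    by (rule sum.reindex_bij_betw[OF bij_betw_flats_by_label, symmetric])
  also have "cl \<dots> = (\<Oplus>\<^bsub>A\<^esub>t\<in>compatible_trees M k v. cl (?term (flats_by_label k t)))"
    using closed by (rule cl_sum)
  also have "\<dots> = (\<Oplus>\<^bsub>A\<^esub>t\<in>compatible_trees M k v.
       case t of (T, \<sigma>, F) \<Rightarrow> chow_scale M (wt T \<sigma> F) (chow_x_chain M T F))"
    using tree_term closed by (intro finsum_cong') (auto simp del: split_paired_All)
  finally show ?thesis .
qed

end

theorem theorem5p2:
  fixes M :: "nat set_system" and n k :: nat and v :: "nat \<Rightarrow> nat"
    and wt :: "vertex set \<Rightarrow> (vertex \<Rightarrow> nat) \<Rightarrow> (vertex \<Rightarrow> nat set) \<Rightarrow> real"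
  assumes "matroid M" and "ground M = {0..n}" and "loopless M"
    and "\<And>i. i \<in> {1..k} \<Longrightarrow> 0 < v i"
    and "wt = wt_OI M v \<or> wt = wt_mult M v"
  shows "(\<Otimes>\<^bsub>chow_ring M\<^esub>i\<in>{1..k}. hypersimplex_class M (v i)) =
           (\<Oplus>\<^bsub>chow_ring M\<^esub>t\<in>compatible_trees M k v.
              case t of (T, \<sigma>, F) \<Rightarrow> chow_scale M (wt T \<sigma> F) (chow_x_chain M T F))"
proof -
  have fin: "finite (ground M)"
    using assms(2) by simp
  then interpret chow M
    by unfold_locales
  show ?thesis
    using assms(5)
  proof
    assume "wt = wt_OI M v"
    then show ?thesis
      using prod_hypersimplex_class[OF deficit_coefficient_OI assms(4) wt_OI_eq_tree_weight[OF fin]]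
      by simp
  next
    assume "wt = wt_mult M v"
    then show ?thesis
      using prod_hypersimplex_class[OF deficit_coefficient_mlt assms(4) wt_mult_eq_tree_weight]
      by simp
  qed
qed

end
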